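(* Let $\Lambda=KQ_\Lambda/I_\Lambda$ be a symmetric special multiserial algebra defined by a defining pair $(\mathcal S,\mu)$ in $Q_\Lambda$ and let $D$ be an admissible cut of $Q_\Lambda$. Let $Q$ be the quiver given by $Q_0=(Q_\Lambda)_0$ and $Q_1=(Q_\Lambda)_1\setminus D$. Then the cut algebra $KQ_\Lambda/\langle I_\Lambda\cup D\rangle$ associated to $D$ is isomorphic to $KQ/(I_\Lambda\cap KQ)$. Moreover, $KQ/(I_\Lambda\cap KQ)$ is an almost gentle algebra.
   Context: $K$ is a field; all algebras are indecomposable and finite dimensional over $K$. Quivers are finite, $Q_0$ and $Q_1$ denote vertices and arrows; $ab$ denotes the arrow $a$ followed by the arrow $b$ (and is $0$ if not composable). For a presentation $KQ/I$ the ideal $I$ is admissible. If $Q$ is a subquiver of $Q_\Lambda$, $KQ$ is viewed inside $KQ_\Lambda$. An algebra is special multiserial if it is Morita equivalent to some $KQ/I$ satisfying (S1): for every $a\in Q_1$ there is at most one arrow $b$ with $ab\notin I$ and at most one arrow $c$ with $ca\notin I$. It is almost gentle if it is Morita equivalent to some $KQ/I$ satisfying (S1) and (S0): $I$ is generated by paths of length 2. A cycle in a quiver is simple if it has no repeated arrows. A defining pair $(\mathcal T,\nu)$ in a quiver consists of a set $\mathcal T$ of simple cycles and a map $\nu\colon\mathcal T\to\mathbb Z_{>0}$ such that: (D0) if $C\in\mathcal T$ is a loop, then $\nu(C)>1$; (D1) $\mathcal T$ is closed under cyclic permutation of cycles; (D2) $\nu(C)=\nu(C')$ if $C'$ is a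 cyclic permutation of $C\in\mathcal T$; (D3) every arrow occurs in some cycle in $\mathcal T$; (D4) if an arrow occurs in two cycles in $\mathcal T$, these are cyclic permutations of each other. The algebra defined by $(\mathcal T,\nu)$ is the path algebra of the quiver modulo the ideal generated by: Type 1: $C^{\nu(C)}-C'^{\nu(C')}$ for $C,C'\in\mathcal T$ at the same vertex; Type 2: $C^{\nu(C)}a$ for $C\in\mathcal T$ with first arrow $a$; Type 3: $ab$ for arrows $a,b$ such that $ab$ is not a subpath of any $C\in\mathcal T$, except when $a=b$ is a loop belonging to $\mathcal T$. "$\Lambda=KQ_\Lambda/I_\Lambda$ is defined by $(\mathcal S,\mu)$" means that $I_\Lambda$ is this ideal. Call two cycles in $\mathcal S$ equivalent if one is a cyclic permutation of the other, and let $C_1,\dots,C_t$ be representatives of the equivalence classes. An admissible cut $D$ of $Q_\Lambda$ is a set of arrows of $Q_\Lambda$ consisting of exactly one arrow from each $C_i$, $i=1,\dots,t$. The cut algebra associated to $D$ is $KQ_\Lambda/\langle I_\Lambda\cup D\rangle$, where $\langle I_\Lambda\cup D\rangle$ is the ideal generated by $I_\Lambda\cup D$. *)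

theory Defs
  imports
    "HOL-Algebra.QuotRing"
    "HOL-Algebra.Ideal_Product"
    "HOL-Algebra.Module"
    "HOL-Library.Poly_Mapping"
    "HOL-Library.Sublist"
    "Graph_Theory.Arc_Walk"
begin

section \<open>Algebras over a field\<close>

text \<open>
  The ground field is a type of class \<open>field\<close>. The locale \<open>algebra\<close> of
  HOL-Algebra is restricted to commutative algebras, so only its record type is reused.
\<close>

locale k_algebra = ring A for A :: "('k::field, 'x) module" (structure) +
  assumes smult_closed: "x \<in> carrier A \<Longrightarrow> c \<odot> x \<in> carrier A"
    and smult_l_distr: "x \<in> carrier A \<Longrightarrow> (c + d) \<odot> x = (c \<odot> x) \<oplus> (d \<odot> x)"
    and smult_r_distr: "\<lbrakk>x \<in> carrier A; y \<in> carrier A\<rbrakk> \<Longrightarrow> c \<odot> (x \<oplus> y) = (c \<odot> x) \<oplus> (c \<odot> y)"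
    and smult_assoc: "x \<in> carrier A \<Longrightarrow> (c * d) \<odot> x = c \<odot> (d \<odot> x)"
    and smult_one: "x \<in> carrier A \<Longrightarrow> 1 \<odot> x = x"
    and smult_mult_l: "\<lbrakk>x \<in> carrier A; y \<in> carrier A\<rbrakk> \<Longrightarrow> (c \<odot> x) \<otimes> y = c \<odot> (x \<otimes> y)"
    and smult_mult_r: "\<lbrakk>x \<in> carrier A; y \<in> carrier A\<rbrakk> \<Longrightarrow> x \<otimes> (c \<odot> y) = c \<odot> (x \<otimes> y)"

definition finite_dimensional :: "('k::field, 'x) module \<Rightarrow> bool" where
  "finite_dimensional A \<longleftrightarrow>
     (\<exists>B. finite B \<and> B \<subseteq> carrier A \<and>
        (\<forall>x\<in>carrier A. \<exists>c. x = (\<Oplus>\<^bsub>A\<^esub>b\<in>B. c b \<odot>\<^bsub>A\<^esub> b)))"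

text \<open>Direct product decompositions of a unital algebra are the same as its decompositions
  into a direct sum of two-sided ideals; the zero algebra is not indecomposable.\<close>

definition indecomposable_algebra :: "('k::field, 'x) module \<Rightarrow> bool" where
  "indecomposable_algebra A \<longleftrightarrow> carrier A \<noteq> {\<zero>\<^bsub>A\<^esub>} \<and>
     (\<forall>I J. ideal I A \<and> ideal J A \<and> I \<inter> J = {\<zero>\<^bsub>A\<^esub>} \<and> I <+>\<^bsub>A\<^esub> J = carrier A
        \<longrightarrow> I = {\<zero>\<^bsub>A\<^esub>} \<or> J = {\<zero>\<^bsub>A\<^esub>})"

definition algebra_iso :: "('k::field, 'x) module \<Rightarrow> ('k, 'y) module \<Rightarrow> bool" where
  "algebra_iso A B \<longleftrightarrow>
     (\<exists>h\<in>ring_iso A B. \<forall>c. \<forall>x\<in>carrier A. h (c \<odot>\<^bsub>A\<^esub> x) = c \<odot>\<^bsub>B\<^esub> h x)"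

text \<open>The quotient ring of HOL-Algebra, with the scalar multiplication
  \<open>c (I + x) = I + c x\<close> added.\<close>

definition quotient_algebra :: "('k::field, 'x) module \<Rightarrow> 'x set \<Rightarrow> ('k, 'x set) module" where
  "quotient_algebra A I =
     ring.extend (A Quot I) (module.fields (\<lambda>c X. \<Union>x\<in>X. I +>\<^bsub>A\<^esub> (c \<odot>\<^bsub>A\<^esub> x)))"

primrec ideal_power :: "('x, 'm) ring_scheme \<Rightarrow> 'x set \<Rightarrow> nat \<Rightarrow> 'x set" where
  "ideal_power R J 0 = carrier R"
| "ideal_power R J (Suc n) = ideal_prod R J (ideal_power R J n)"

subsection \<open>Symmetric algebras\<close>

definition dual_space :: "('k::field, 'x) module \<Rightarrow> ('x \<Rightarrow> 'k) set" where
  "dual_space A = {f \<in> extensional (carrier A).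
     (\<forall>x\<in>carrier A. \<forall>y\<in>carrier A. f (x \<oplus>\<^bsub>A\<^esub> y) = f x + f y) \<and>
     (\<forall>c. \<forall>x\<in>carrier A. f (c \<odot>\<^bsub>A\<^esub> x) = c * f x)}"

text \<open>\<open>A\<close> is symmetric if it is isomorphic, as a bimodule over itself, to its dual
  \<open>Hom\<^sub>K(A, K)\<close>, on which \<open>A\<close> acts by \<open>(a f b)(z) = f (b z a)\<close>.\<close>

definition symmetric_algebra :: "('k::field, 'x) module \<Rightarrow> bool" where
  "symmetric_algebra A \<longleftrightarrow>
     (\<exists>\<phi>. bij_betw \<phi> (carrier A) (dual_space A) \<and>
        (\<forall>x\<in>carrier A. \<forall>y\<in>carrier A.
           \<phi> (x \<oplus>\<^bsub>A\<^esub> y) = (\<lambda>z\<in>carrier A. \<phi> x z + \<phi> y z)) \<and>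
        (\<forall>a\<in>carrier A. \<forall>b\<in>carrier A. \<forall>x\<in>carrier A.
           \<phi> (a \<otimes>\<^bsub>A\<^esub> x \<otimes>\<^bsub>A\<^esub> b) = (\<lambda>z\<in>carrier A. \<phi> x (b \<otimes>\<^bsub>A\<^esub> z \<otimes>\<^bsub>A\<^esub> a))))"

subsection \<open>Modules and Morita equivalence\<close>

text \<open>A left module is given by the record type of HOL-Algebra, whose fields \<open>mult\<close> and
  \<open>one\<close> play no role for modules.\<close>

definition left_module :: "('x, 'n) ring_scheme \<Rightarrow> ('x, 'm) module \<Rightarrow> bool" where
  "left_module A M \<longleftrightarrow> ring A \<and> abelian_group M \<and>
     (\<forall>a\<in>carrier A. \<forall>x\<in>carrier M. a \<odot>\<^bsub>M\<^esub> x \<in> carrier M) \<and>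
     (\<forall>a\<in>carrier A. \<forall>b\<in>carrier A. \<forall>x\<in>carrier M.
        (a \<oplus>\<^bsub>A\<^esub> b) \<odot>\<^bsub>M\<^esub> x = (a \<odot>\<^bsub>M\<^esub> x) \<oplus>\<^bsub>M\<^esub> (b \<odot>\<^bsub>M\<^esub> x)) \<and>
     (\<forall>a\<in>carrier A. \<forall>x\<in>carrier M. \<forall>y\<in>carrier M.
        a \<odot>\<^bsub>M\<^esub> (x \<oplus>\<^bsub>M\<^esub> y) = (a \<odot>\<^bsub>M\<^esub> x) \<oplus>\<^bsub>M\<^esub> (a \<odot>\<^bsub>M\<^esub> y)) \<and>
     (\<forall>a\<in>carrier A. \<forall>b\<in>carrier A. \<forall>x\<in>carrier M.
        (a \<otimes>\<^bsub>A\<^esub> b) \<odot>\<^bsub>M\<^esub> x = a \<odot>\<^bsub>M\<^esub> (b \<odot>\<^bsub>M\<^esub> x)) \<and>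
     (\<forall>x\<in>carrier M. \<one>\<^bsub>A\<^esub> \<odot>\<^bsub>M\<^esub> x = x)"

definition finitely_generated :: "('x, 'n) ring_scheme \<Rightarrow> ('x, 'm) module \<Rightarrow> bool" where
  "finitely_generated A M \<longleftrightarrow>
     (\<exists>G. finite G \<and> G \<subseteq> carrier M \<and>
        (\<forall>x\<in>carrier M. \<exists>c\<in>G \<rightarrow> carrier A. x = (\<Oplus>\<^bsub>M\<^esub>g\<in>G. c g \<odot>\<^bsub>M\<^esub> g)))"

text \<open>The objects of the category of finitely generated modules over a finite dimensional
  algebra. Such a module is finite dimensional over \<open>K\<close>, so up to isomorphism its elements
  may be taken from the type \<open>nat \<Rightarrow> 'k\<close>, which contains a copy of \<open>K\<^sup>n\<close> for every \<open>n\<close>.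
  Both the underlying set and the operations are otherwise arbitrary.\<close>

definition fg_modules :: "('k::field, 'x) module \<Rightarrow> ('x, nat \<Rightarrow> 'k) module set" where
  "fg_modules A = {M. left_module A M \<and> finitely_generated A M}"

definition module_hom ::
    "('x, 'n) ring_scheme \<Rightarrow> ('x, 'm) module \<Rightarrow> ('x, 'm) module \<Rightarrow> ('m \<Rightarrow> 'm) set" where
  "module_hom A M N = {f \<in> carrier M \<rightarrow>\<^sub>E carrier N.
     (\<forall>x\<in>carrier M. \<forall>y\<in>carrier M. f (x \<oplus>\<^bsub>M\<^esub> y) = f x \<oplus>\<^bsub>N\<^esub> f y) \<and>
     (\<forall>a\<in>carrier A. \<forall>x\<in>carrier M. f (a \<odot>\<^bsub>M\<^esub> x) = a \<odot>\<^bsub>N\<^esub> f x)}"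

text \<open>A \<open>K\<close>-linear functor from finitely generated \<open>A\<close>-modules to finitely generated
  \<open>B\<close>-modules that is fully faithful and essentially surjective. A scalar \<open>c\<close> of \<open>K\<close> acts on
  a module through \<open>c 1\<^sub>A\<close>, respectively \<open>c 1\<^sub>B\<close>.\<close>

definition module_equivalence ::
    "('k::field, 'x) module \<Rightarrow> ('k, 'y) module \<Rightarrow>
     (('x, nat \<Rightarrow> 'k) module \<Rightarrow> ('y, nat \<Rightarrow> 'k) module) \<Rightarrow>
     (('x, nat \<Rightarrow> 'k) module \<Rightarrow> ('x, nat \<Rightarrow> 'k) module \<Rightarrow>
        ((nat \<Rightarrow> 'k) \<Rightarrow> (nat \<Rightarrow> 'k)) \<Rightarrow> ((nat \<Rightarrow> 'k) \<Rightarrow> (nat \<Rightarrow> 'k))) \<Rightarrow> bool" where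
  "module_equivalence A B Fo Fm \<longleftrightarrow>
     Fo ` fg_modules A \<subseteq> fg_modules B \<and>
     (\<forall>M\<in>fg_modules A. \<forall>N\<in>fg_modules A.
        bij_betw (Fm M N) (module_hom A M N) (module_hom B (Fo M) (Fo N))) \<and>
     (\<forall>M\<in>fg_modules A. Fm M M (\<lambda>x\<in>carrier M. x) = (\<lambda>x\<in>carrier (Fo M). x)) \<and>
     (\<forall>M\<in>fg_modules A. \<forall>N\<in>fg_modules A. \<forall>L\<in>fg_modules A.
        \<forall>f\<in>module_hom A M N. \<forall>g\<in>module_hom A N L.
          Fm M L (compose (carrier M) g f) = compose (carrier (Fo M)) (Fm N L g) (Fm M N f)) \<and>
     (\<forall>M\<in>fg_modules A. \<forall>N\<in>fg_modules A. \<forall>f\<in>module_hom A M N. \<forall>g\<in>module_hom A M N.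
        Fm M N (\<lambda>x\<in>carrier M. f x \<oplus>\<^bsub>N\<^esub> g x)
          = (\<lambda>x\<in>carrier (Fo M). Fm M N f x \<oplus>\<^bsub>Fo N\<^esub> Fm M N g x)) \<and>
     (\<forall>M\<in>fg_modules A. \<forall>N\<in>fg_modules A. \<forall>f\<in>module_hom A M N. \<forall>c.
        Fm M N (\<lambda>x\<in>carrier M. (c \<odot>\<^bsub>A\<^esub> \<one>\<^bsub>A\<^esub>) \<odot>\<^bsub>N\<^esub> f x)
          = (\<lambda>x\<in>carrier (Fo M). (c \<odot>\<^bsub>B\<^esub> \<one>\<^bsub>B\<^esub>) \<odot>\<^bsub>Fo N\<^esub> Fm M N f x)) \<and>
     (\<forall>N\<in>fg_modules B. \<exists>M\<in>fg_modules A. \<exists>f\<in>module_hom B (Fo M) N.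
        bij_betw f (carrier (Fo M)) (carrier N))"

definition morita_equivalent :: "('k::field, 'x) module \<Rightarrow> ('k, 'y) module \<Rightarrow> bool" where
  "morita_equivalent A B \<longleftrightarrow> (\<exists>Fo Fm. module_equivalence A B Fo Fm)"

section \<open>Path algebras\<close>

text \<open>A finite quiver is a \<open>fin_digraph\<close> (loops and multiple arrows are allowed). A path is
  a pair of its source and its list of arrows, so that \<open>(v, [])\<close> is the trivial path at \<open>v\<close>.
  Deleting arrows from a quiver shrinks the carrier of its path algebra and changes none of the
  operations on the smaller carrier, so the path algebra of a subquiver with the same vertices
  literally is a subalgebra.\<close>

type_synonym ('v, 'a) quiver_path = "'v \<times> 'a list"

definition quiver_paths :: "('v, 'a) pre_digraph \<Rightarrow> ('v, 'a) quiver_path set" where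
  "quiver_paths Q = {(u, p). \<exists>v. pre_digraph.awalk Q u p v}"

definition path_target :: "('v, 'a) pre_digraph \<Rightarrow> ('v, 'a) quiver_path \<Rightarrow> 'v" where
  "path_target Q p = pre_digraph.awlast Q (fst p) (snd p)"

definition path_mult ::
    "('v, 'a) pre_digraph \<Rightarrow> (('v, 'a) quiver_path \<Rightarrow>\<^sub>0 'k::field) \<Rightarrow>
     (('v, 'a) quiver_path \<Rightarrow>\<^sub>0 'k) \<Rightarrow> (('v, 'a) quiver_path \<Rightarrow>\<^sub>0 'k)" where
  "path_mult Q f g =
     (\<Sum>p\<in>Poly_Mapping.keys f. \<Sum>q\<in>Poly_Mapping.keys g.
        if path_target Q p = fst q
        then Poly_Mapping.single (fst p, snd p @ snd q) (Poly_Mapping.lookup f p * Poly_Mapping.lookup g q)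
        else 0)"

definition path_algebra ::
    "('v, 'a) pre_digraph \<Rightarrow> ('k::field, ('v, 'a) quiver_path \<Rightarrow>\<^sub>0 'k) module" where
  "path_algebra Q =
     \<lparr>carrier = {f. Poly_Mapping.keys f \<subseteq> quiver_paths Q},
      monoid.mult = path_mult Q,
      one = (\<Sum>v\<in>verts Q. Poly_Mapping.single (v, []) 1),
      ring.zero = 0,
      add = (+),
      smult = (\<lambda>c. Poly_Mapping.map ((*) c))\<rparr>"

text \<open>The element of the path algebra given by a nonempty path.\<close>

definition path_elem ::
    "('v, 'a) pre_digraph \<Rightarrow> 'a list \<Rightarrow> (('v, 'a) quiver_path \<Rightarrow>\<^sub>0 'k::field)" where
  "path_elem Q p = Poly_Mapping.single (tail Q (hd p), p) 1"

definition arrow_elem :: "('v, 'a) pre_digraph \<Rightarrow> 'a \<Rightarrow> (('v, 'a) quiver_path \<Rightarrow>\<^sub>0 'k::field)" where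
  "arrow_elem Q a = path_elem Q [a]"

definition arrow_ideal :: "('v, 'a) pre_digraph \<Rightarrow> (('v, 'a) quiver_path \<Rightarrow>\<^sub>0 'k::field) set" where
  "arrow_ideal Q = Idl\<^bsub>path_algebra Q\<^esub> (arrow_elem Q ` arcs Q)"

definition admissible_ideal ::
    "('v, 'a) pre_digraph \<Rightarrow> (('v, 'a) quiver_path \<Rightarrow>\<^sub>0 'k::field) set \<Rightarrow> bool" where
  "admissible_ideal Q I \<longleftrightarrow> ideal I (path_algebra Q) \<and>
     I \<subseteq> ideal_power (path_algebra Q) (arrow_ideal Q) 2 \<and>
     (\<exists>m\<ge>2. ideal_power (path_algebra Q) (arrow_ideal Q) m \<subseteq> I)"

section \<open>Special multiserial and almost gentle algebras\<close>

definition cond_S1 ::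
    "('v, 'a) pre_digraph \<Rightarrow> (('v, 'a) quiver_path \<Rightarrow>\<^sub>0 'k::field) set \<Rightarrow> bool" where
  "cond_S1 Q I \<longleftrightarrow> (\<forall>a\<in>arcs Q.
     (\<exists>\<^sub>\<le>\<^sub>1b. b \<in> arcs Q \<and> arrow_elem Q a \<otimes>\<^bsub>path_algebra Q\<^esub> arrow_elem Q b \<notin> I) \<and>
     (\<exists>\<^sub>\<le>\<^sub>1c. c \<in> arcs Q \<and> arrow_elem Q c \<otimes>\<^bsub>path_algebra Q\<^esub> arrow_elem Q a \<notin> I))"

definition cond_S0 ::
    "('v, 'a) pre_digraph \<Rightarrow> (('v, 'a) quiver_path \<Rightarrow>\<^sub>0 'k::field) set \<Rightarrow> bool" where
  "cond_S0 Q I \<longleftrightarrow>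
     (\<exists>P \<subseteq> {p. length p = 2 \<and> (\<exists>u v. pre_digraph.awalk Q u p v)}.
        I = Idl\<^bsub>path_algebra Q\<^esub> (path_elem Q ` P))"

text \<open>All algebras are assumed to be indecomposable and finite dimensional, so these conditions
  are part of the definitions. Every finite quiver is isomorphic to one whose vertices and arrows
  are natural numbers.\<close>

definition special_multiserial :: "('k::field, 'x) module \<Rightarrow> bool" where
  "special_multiserial A \<longleftrightarrow>
     k_algebra A \<and> finite_dimensional A \<and> indecomposable_algebra A \<and>
     (\<exists>(Q :: (nat, nat) pre_digraph) I.
        fin_digraph Q \<and> admissible_ideal Q I \<and> cond_S1 Q I \<and>
        morita_equivalent A (quotient_algebra (path_algebra Q) I))"

definition almost_gentle :: "('k::field, 'x) module \<Rightarrow> bool" where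
  "almost_gentle A \<longleftrightarrow>
     k_algebra A \<and> finite_dimensional A \<and> indecomposable_algebra A \<and>
     (\<exists>(Q :: (nat, nat) pre_digraph) I.
        fin_digraph Q \<and> admissible_ideal Q I \<and> cond_S1 Q I \<and> cond_S0 Q I \<and>
        morita_equivalent A (quotient_algebra (path_algebra Q) I))"

section \<open>Defining pairs and admissible cuts\<close>

text \<open>A cycle is a nonempty closed walk with a chosen starting point, given by its list of
  arrows.\<close>

definition simple_cycle :: "('v, 'a) pre_digraph \<Rightarrow> 'a list \<Rightarrow> bool" where
  "simple_cycle Q C \<longleftrightarrow> C \<noteq> [] \<and>
     pre_digraph.awalk Q (tail Q (hd C)) C (tail Q (hd C)) \<and> distinct C"

definition cyclic_perm :: "'a list \<Rightarrow> 'a list \<Rightarrow> bool" where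
  "cyclic_perm C C' \<longleftrightarrow> (\<exists>n. C' = rotate n C)"

definition defining_pair :: "('v, 'a) pre_digraph \<Rightarrow> 'a list set \<Rightarrow> ('a list \<Rightarrow> nat) \<Rightarrow> bool" where
  "defining_pair Q T \<nu> \<longleftrightarrow>
     (\<forall>C\<in>T. simple_cycle Q C \<and> \<nu> C > 0) \<and>
     (\<forall>C\<in>T. length C = 1 \<longrightarrow> \<nu> C > 1) \<and>
     (\<forall>C\<in>T. \<forall>C'. cyclic_perm C C' \<longrightarrow> C' \<in> T) \<and>
     (\<forall>C\<in>T. \<forall>C'. cyclic_perm C C' \<longrightarrow> \<nu> C = \<nu> C') \<and>
     (\<forall>a\<in>arcs Q. \<exists>C\<in>T. a \<in> set C) \<and>
     (\<forall>a. \<forall>C\<in>T. \<forall>C'\<in>T. a \<in> set C \<and> a \<in> set C' \<longrightarrow> cyclic_perm C C')"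

definition type1_relations ::
    "('v, 'a) pre_digraph \<Rightarrow> 'a list set \<Rightarrow> ('a list \<Rightarrow> nat) \<Rightarrow>
     (('v, 'a) quiver_path \<Rightarrow>\<^sub>0 'k::field) set" where
  "type1_relations Q T \<nu> =
     {path_elem Q C [^]\<^bsub>path_algebra Q\<^esub> \<nu> C - path_elem Q C' [^]\<^bsub>path_algebra Q\<^esub> \<nu> C' | C C'.
        C \<in> T \<and> C' \<in> T \<and> tail Q (hd C) = tail Q (hd C')}"

definition type2_relations ::
    "('v, 'a) pre_digraph \<Rightarrow> 'a list set \<Rightarrow> ('a list \<Rightarrow> nat) \<Rightarrow>
     (('v, 'a) quiver_path \<Rightarrow>\<^sub>0 'k::field) set" where
  "type2_relations Q T \<nu> =
     {(path_elem Q C [^]\<^bsub>path_algebra Q\<^esub> \<nu> C) \<otimes>\<^bsub>path_algebra Q\<^esub> arrow_elem Q (hd C) | C. C \<in> T}"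

definition type3_relations ::
    "('v, 'a) pre_digraph \<Rightarrow> 'a list set \<Rightarrow> (('v, 'a) quiver_path \<Rightarrow>\<^sub>0 'k::field) set" where
  "type3_relations Q T =
     {arrow_elem Q a \<otimes>\<^bsub>path_algebra Q\<^esub> arrow_elem Q b | a b.
        a \<in> arcs Q \<and> b \<in> arcs Q \<and> (\<forall>C\<in>T. \<not> sublist [a, b] C) \<and> \<not> (a = b \<and> [a] \<in> T)}"

definition defining_ideal ::
    "('v, 'a) pre_digraph \<Rightarrow> 'a list set \<Rightarrow> ('a list \<Rightarrow> nat) \<Rightarrow>
     (('v, 'a) quiver_path \<Rightarrow>\<^sub>0 'k::field) set" where
  "defining_ideal Q T \<nu> =
     Idl\<^bsub>path_algebra Q\<^esub> (type1_relations Q T \<nu> \<union> type2_relations Q T \<nu> \<union> type3_relations Q T)"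

definition cycle_representatives :: "'a list set \<Rightarrow> 'a list set \<Rightarrow> bool" where
  "cycle_representatives T R \<longleftrightarrow> R \<subseteq> T \<and> (\<forall>C\<in>T. \<exists>!C'. C' \<in> R \<and> cyclic_perm C C')"

definition admissible_cut ::
    "('v, 'a) pre_digraph \<Rightarrow> 'a list set \<Rightarrow> 'a set \<Rightarrow> bool" where
  "admissible_cut Q R D \<longleftrightarrow> D \<subseteq> arcs Q \<and> (\<forall>C\<in>R. \<exists>!a. a \<in> D \<inter> set C)"

definition cut_algebra ::
    "('v, 'a) pre_digraph \<Rightarrow> (('v, 'a) quiver_path \<Rightarrow>\<^sub>0 'k::field) set \<Rightarrow> 'a set \<Rightarrow>
     ('k, (('v, 'a) quiver_path \<Rightarrow>\<^sub>0 'k) set) module" where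
  "cut_algebra Q I D =
     quotient_algebra (path_algebra Q) (Idl\<^bsub>path_algebra Q\<^esub> (I \<union> arrow_elem Q ` D))"

end

theory Submission
  imports Defs
begin

text \<open>
  Killing the arrows of \<open>D\<close> is a surjective homomorphism \<open>\<pi>\<close> from \<open>KQ\<^sub>\<Lambda>\<close> onto \<open>KQ\<close> that is the identity
  on \<open>KQ\<close>. Every cycle of \<open>S\<close> contains an arrow of \<open>D\<close>, so \<open>\<pi>\<close> kills the relations of types 1 and 2,
  and \<open>\<pi>(I\<^sub>\<Lambda>) = I\<^sub>\<Lambda> \<inter> KQ\<close> is generated by the relations of type 3 between arrows of \<open>Q\<close>, which are paths
  of length 2. This gives the isomorphism and (S0). A path in \<open>Q\<close> without such a relation is an
  initial segment of a cycle of \<open>S\<close>, because an arrow has only one successor along the cycles; hence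
  its length is bounded and the ideal is admissible, and (S1) is the uniqueness of successors and
  predecessors.

  For indecomposability, \<open>\<Lambda>\<close> being indecomposable forces \<open>Q\<^sub>\<Lambda>\<close> to be connected. A cycle minus
  one arrow still joins the ends of that arrow, so \<open>Q\<close> is connected. In the quotient by an admissible
  ideal the coefficients of a central idempotent at the vertices are 0 or 1 and agree at the ends of
  each arrow; when they are all 0 the idempotent lies in the radical and vanishes.
\<close>

section \<open>Path algebras\<close>

text \<open>The two halves of "exactly one arrow per cycle" do different work. At least one cut
  arrow makes \<open>\<pi>\<close> kill the powers of the cycles, puts every loop of
  \<open>S\<close> into \<open>D\<close>, and stops a path of \<open>Q\<close> from running all the
  way around a cycle, which bounds its length. At most one cut arrow is what keeps \<open>Q\<close>
  connected. The definition of \<open>almost_gentle\<close> includes finite dimension and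
  indecomposability and asks for a presentation whose vertices and arrows are natural numbers, up to
  Morita equivalence. A concrete quotient of \<open>KQ\<close> must therefore still be renamed, and
  the resulting isomorphism must be turned into an equivalence of module categories.
  Indecomposability is carried from \<open>\<Lambda>\<close> to the cut through connectedness, a
  property of the quiver alone; this is why admissibility of both ideals matters beyond the
  definition, since it keeps the vertices nonzero and makes the radical nilpotent.\<close>

lemma poly_mapping_sum_keys:
  "(\<Sum>p\<in>Poly_Mapping.keys f. Poly_Mapping.single p (Poly_Mapping.lookup f p)) = f"
proof (rule poly_mapping_eqI)
  fix k
  show "Poly_Mapping.lookup (\<Sum>p\<in>Poly_Mapping.keys f. Poly_Mapping.single p (Poly_Mapping.lookup f p)) k
      = Poly_Mapping.lookup f k"
    by (cases "k \<in> Poly_Mapping.keys f")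
      (auto simp: lookup_sum lookup_single when_def not_in_keys_iff_lookup_eq_zero sum.delta)
qed

text \<open>Statements linear in \<open>f\<close> reduce to scalar multiples of single paths. The
  support bounds in the \<open>add\<close> case let hypotheses on paths survive in inductions over
  the carrier.\<close>

lemma poly_mapping_span_induct [consumes 1, case_names zero single add]:
  fixes f :: "'p \<Rightarrow>\<^sub>0 'k::comm_monoid_add"
  assumes "Poly_Mapping.keys f \<subseteq> X"
    and "P 0"
    and single: "\<And>p c. p \<in> X \<Longrightarrow> P (Poly_Mapping.single p c)"
    and add: "\<And>f g. \<lbrakk>P f; P g; Poly_Mapping.keys f \<subseteq> X; Poly_Mapping.keys g \<subseteq> X\<rbrakk> \<Longrightarrow> P (f + g)"
  shows "P f"
proof -
  let ?s = "\<lambda>A. \<Sum>p\<in>A. Poly_Mapping.single p (Poly_Mapping.lookup f p)"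
  have "P (?s A) \<and> Poly_Mapping.keys (?s A) \<subseteq> X" if "finite A" "A \<subseteq> X" for A
    using that
  proof (induction A)
    case empty
    then show ?case using assms(2) by simp
  next
    case (insert x A)
    have 1: "Poly_Mapping.keys (Poly_Mapping.single x (Poly_Mapping.lookup f x)) \<subseteq> X"
      using insert.prems by auto
    then have "Poly_Mapping.keys (Poly_Mapping.single x (Poly_Mapping.lookup f x) + ?s A) \<subseteq> X"
      using insert keys_add[of "Poly_Mapping.single x (Poly_Mapping.lookup f x)" "?s A"] by blast
    then show ?case using insert 1 add single by simp
  qed
  from this[OF finite_keys assms(1)] show ?thesis by (simp add: poly_mapping_sum_keys)
qed

lemmas poly_mapping_linear_induct = poly_mapping_span_induct[OF subset_UNIV, case_names zero single add]

lemma path_target_simp: "path_target Q (u, p) = (if p = [] then u else head Q (last p))"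
  by (simp add: path_target_def pre_digraph.awalk_verts_conv)

lemma path_target_append:
  "path_target Q p = fst q \<Longrightarrow> path_target Q (fst p, snd p @ snd q) = path_target Q q"
  by (cases p; cases q) (auto simp: path_target_simp split: if_splits)

text \<open>Cancellation can make the support of a sum smaller than the union of the supports.
  Summing over a common finite superset puts both sides of a linearity law over the same index
  set.\<close>

lemma path_mult_superset:
  assumes "finite A" "finite B" "Poly_Mapping.keys f \<subseteq> A" "Poly_Mapping.keys g \<subseteq> B"
  shows "path_mult Q f g = (\<Sum>p\<in>A. \<Sum>q\<in>B. if path_target Q p = fst q
     then Poly_Mapping.single (fst p, snd p @ snd q) (Poly_Mapping.lookup f p * Poly_Mapping.lookup g q) else 0)"
proof -
  have "path_mult Q f g = (\<Sum>p\<in>Poly_Mapping.keys f. \<Sum>q\<in>B. if path_target Q p = fst q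
     then Poly_Mapping.single (fst p, snd p @ snd q) (Poly_Mapping.lookup f p * Poly_Mapping.lookup g q) else 0)"
    unfolding path_mult_def using assms
    by (intro sum.cong refl sum.mono_neutral_left) (auto simp: not_in_keys_iff_lookup_eq_zero)
  also have "\<dots> = (\<Sum>p\<in>A. \<Sum>q\<in>B. if path_target Q p = fst q
     then Poly_Mapping.single (fst p, snd p @ snd q) (Poly_Mapping.lookup f p * Poly_Mapping.lookup g q) else 0)"
    using assms
    by (intro sum.mono_neutral_left) (auto simp: not_in_keys_iff_lookup_eq_zero intro!: sum.neutral)
  finally show ?thesis .
qed

lemma path_mult_add_left: "path_mult Q (f + f') g = path_mult Q f g + path_mult Q f' g"
proof -
  let ?A = "Poly_Mapping.keys f \<union> Poly_Mapping.keys f'" and ?B = "Poly_Mapping.keys g"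
  have k: "Poly_Mapping.keys (f + f') \<subseteq> ?A" by (rule keys_add)
  show ?thesis
    by (subst (1 2 3) path_mult_superset[where A = ?A and B = ?B])
      (use k in \<open>auto simp: sum.distrib[symmetric] lookup_add distrib_right single_add intro!: sum.cong\<close>)
qed

lemma path_mult_add_right: "path_mult Q f (g + g') = path_mult Q f g + path_mult Q f g'"
proof -
  let ?A = "Poly_Mapping.keys f" and ?B = "Poly_Mapping.keys g \<union> Poly_Mapping.keys g'"
  have k: "Poly_Mapping.keys (g + g') \<subseteq> ?B" by (rule keys_add)
  show ?thesis
    by (subst (1 2 3) path_mult_superset[where A = ?A and B = ?B])
      (use k in \<open>auto simp: sum.distrib[symmetric] lookup_add distrib_left single_add intro!: sum.cong\<close>)
qed

lemma path_mult_zero [simp]: "path_mult Q 0 g = 0" "path_mult Q f 0 = 0"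
  by (simp_all add: path_mult_def)

lemma path_mult_single:
  "path_mult Q (Poly_Mapping.single p c) (Poly_Mapping.single q d) =
     (if path_target Q p = fst q then Poly_Mapping.single (fst p, snd p @ snd q) (c * d) else 0)"
  by (subst path_mult_superset[where A = "{p}" and B = "{q}"]) auto

text \<open>Trilinearity reduces the claim to three paths, where it is associativity of
  concatenation. The product only compares an end point with a starting vertex, so the law holds on
  the whole type and not just on the carrier.\<close>

lemma path_mult_assoc: "path_mult Q (path_mult Q f g) h = path_mult Q f (path_mult Q g h)"
proof (induction f rule: poly_mapping_linear_induct)
  case (single p c)
  show ?case
  proof (induction g rule: poly_mapping_linear_induct)
    case (single q d)
    show ?case
    proof (induction h rule: poly_mapping_linear_induct)
      case (single r e)
      show ?case
        by (auto simp: path_mult_single path_target_append mult.assoc)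
    qed (simp_all add: path_mult_add_right)
  qed (simp_all add: path_mult_add_right path_mult_add_left)
qed (simp_all add: path_mult_add_left)

text \<open>Only an inclusion: different pairs of paths can have the same concatenation, and their
  coefficients can cancel.\<close>

lemma keys_path_mult:
  "Poly_Mapping.keys (path_mult Q f g) \<subseteq>
     {(fst p, snd p @ snd q) | p q. p \<in> Poly_Mapping.keys f \<and> q \<in> Poly_Mapping.keys g \<and> path_target Q p = fst q}"
  unfolding path_mult_def
  by (rule order_trans[OF keys_sum], rule UN_least, rule order_trans[OF keys_sum])
    (fastforce split: if_splits)

lemma lookup_map_times [simp]:
  "Poly_Mapping.lookup (Poly_Mapping.map ((*) c) f) p = c * Poly_Mapping.lookup f (p :: 'p)" for c :: "'k::field"
  by (simp add: Poly_Mapping.map.rep_eq when_def)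

lemma map_times_zero [simp]: "Poly_Mapping.map ((*) c) 0 = 0" for c :: "'k::field"
  by (rule poly_mapping_eqI) simp

lemma keys_map_times: "Poly_Mapping.keys (Poly_Mapping.map ((*) c) f) \<subseteq> Poly_Mapping.keys f" for c :: "'k::field"
  by (auto simp: in_keys_iff)

lemma map_times_add:
  "Poly_Mapping.map ((*) c) (f + g) = Poly_Mapping.map ((*) c) f + Poly_Mapping.map ((*) c) g" for c :: "'k::field"
  by (rule poly_mapping_eqI) (simp add: lookup_add distrib_left)

lemma map_times_add_scalar:
  "Poly_Mapping.map ((*) (c + d)) f = Poly_Mapping.map ((*) c) f + Poly_Mapping.map ((*) d) f" for c :: "'k::field"
  by (rule poly_mapping_eqI) (simp add: lookup_add distrib_right)

lemma map_times_single:
  "Poly_Mapping.map ((*) c) (Poly_Mapping.single p d) = Poly_Mapping.single p (c * d)" for c :: "'k::field"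
  by (rule poly_mapping_eqI) (simp add: lookup_single when_def)

lemma path_mult_map_times:
  shows "path_mult Q (Poly_Mapping.map ((*) c) f) g = Poly_Mapping.map ((*) c) (path_mult Q f g)"
    and "path_mult Q f (Poly_Mapping.map ((*) c) g) = Poly_Mapping.map ((*) c) (path_mult Q f g)"
proof -
  have "path_mult Q (Poly_Mapping.map ((*) c) f) g = Poly_Mapping.map ((*) c) (path_mult Q f g) \<and>
    path_mult Q f (Poly_Mapping.map ((*) c) g) = Poly_Mapping.map ((*) c) (path_mult Q f g)"
  proof (induction f rule: poly_mapping_linear_induct)
    case (single p d)
    show ?case
      by (induction g rule: poly_mapping_linear_induct)
        (auto simp: map_times_single path_mult_single path_mult_add_right map_times_add mult.left_commute mult.assoc)
  qed (auto simp: map_times_add path_mult_add_left)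
  then show "path_mult Q (Poly_Mapping.map ((*) c) f) g = Poly_Mapping.map ((*) c) (path_mult Q f g)"
    and "path_mult Q f (Poly_Mapping.map ((*) c) g) = Poly_Mapping.map ((*) c) (path_mult Q f g)" by auto
qed

lemma quiver_paths_target:
  assumes "wf_digraph Q"
  shows "p \<in> quiver_paths Q \<longleftrightarrow> pre_digraph.awalk Q (fst p) (snd p) (path_target Q p)"
proof -
  interpret wf_digraph Q by fact
  show ?thesis by (cases p) (auto simp: quiver_paths_def path_target_def)
qed

context wf_digraph
begin

lemma quiver_paths_append:
  assumes "p \<in> quiver_paths G" "q \<in> quiver_paths G" "path_target G p = fst q"
  shows "(fst p, snd p @ snd q) \<in> quiver_paths G"
  using assms by (auto simp: quiver_paths_def path_target_def intro: awalk_appendI)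

lemma quiver_paths_appendD:
  assumes "(u, p @ q) \<in> quiver_paths G"
  shows "(u, p) \<in> quiver_paths G" "(path_target G (u, p), q) \<in> quiver_paths G"
  using assms by (auto simp: quiver_paths_def path_target_def)

lemma quiver_paths_Nil [simp]: "(u, []) \<in> quiver_paths G \<longleftrightarrow> u \<in> verts G"
  by (auto simp: quiver_paths_def awalk_Nil_iff)

lemma quiver_paths_Cons:
  "(u, a # p) \<in> quiver_paths G \<longleftrightarrow> a \<in> arcs G \<and> u = tail G a \<and> (head G a, p) \<in> quiver_paths G"
  by (auto simp: quiver_paths_def awalk_Cons_iff)

lemma quiver_paths_verts:
  assumes "p \<in> quiver_paths G"
  shows "fst p \<in> verts G" "path_target G p \<in> verts G"
  using assms by (auto simp: quiver_paths_target[OF wf_digraph_axioms] awalk_hd_in_verts awalk_last_in_verts)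

lemma quiver_paths_arcs: "(u, p) \<in> quiver_paths G \<Longrightarrow> set p \<subseteq> arcs G"
  by (auto simp: quiver_paths_def)

lemma path_mult_closed:
  assumes "Poly_Mapping.keys f \<subseteq> quiver_paths G" "Poly_Mapping.keys g \<subseteq> quiver_paths G"
  shows "Poly_Mapping.keys (path_mult G f g) \<subseteq> quiver_paths G"
  using keys_path_mult[of G f g] assms quiver_paths_append by blast

end

lemma path_mult_sum_left: "path_mult Q (\<Sum>i\<in>A. f i) g = (\<Sum>i\<in>A. path_mult Q (f i) g)"
  by (induction A rule: infinite_finite_induct) (simp_all add: path_mult_add_left)

lemma path_mult_sum_right: "path_mult Q g (\<Sum>i\<in>A. f i) = (\<Sum>i\<in>A. path_mult Q g (f i))"
  by (induction A rule: infinite_finite_induct) (simp_all add: path_mult_add_right)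

text \<open>These sums are the idempotents attached to vertex sets. \<open>W = verts Q\<close> gives
  the unit laws, and a union of components gives the projections that split a disconnected
  quotient.\<close>

lemma lookup_path_mult_vertices:
  assumes "finite W"
  shows "Poly_Mapping.lookup (path_mult Q (\<Sum>v\<in>W. Poly_Mapping.single (v, []) 1) f) p =
      (if fst p \<in> W then Poly_Mapping.lookup f p else 0)"
    and "Poly_Mapping.lookup (path_mult Q f (\<Sum>v\<in>W. Poly_Mapping.single (v, []) 1)) p =
      (if path_target Q p \<in> W then Poly_Mapping.lookup f p else 0)"
proof -
  show "Poly_Mapping.lookup (path_mult Q (\<Sum>v\<in>W. Poly_Mapping.single (v, []) 1) f) p =
      (if fst p \<in> W then Poly_Mapping.lookup f p else 0)"
  proof (induction f rule: poly_mapping_linear_induct)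
    case (single q c)
    show ?case using assms
      by (auto simp: path_mult_sum_left path_mult_single path_target_simp lookup_sum sum.delta lookup_single when_def
          if_distrib[of "\<lambda>f. Poly_Mapping.lookup f p"] cong: if_cong)
  qed (simp_all add: path_mult_add_right lookup_add)
  show "Poly_Mapping.lookup (path_mult Q f (\<Sum>v\<in>W. Poly_Mapping.single (v, []) 1)) p =
      (if path_target Q p \<in> W then Poly_Mapping.lookup f p else 0)"
  proof (induction f rule: poly_mapping_linear_induct)
    case (single q c)
    show ?case using assms
      by (auto simp: path_mult_sum_right path_mult_single path_target_simp lookup_sum sum.delta lookup_single when_def
          if_distrib[of "\<lambda>f. Poly_Mapping.lookup f p"] cong: if_cong)
  qed (simp_all add: path_mult_add_left lookup_add)
qed

section \<open>The path algebra as a unital algebra over the field\<close>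

lemma path_algebra_simps [simp]:
  "carrier (path_algebra Q) = {f. Poly_Mapping.keys f \<subseteq> quiver_paths Q}"
  "monoid.mult (path_algebra Q) = path_mult Q"
  "\<one>\<^bsub>path_algebra Q\<^esub> = (\<Sum>v\<in>verts Q. Poly_Mapping.single (v, []) 1)"
  "\<zero>\<^bsub>path_algebra Q\<^esub> = 0"
  "add (path_algebra Q) = (+)"
  "smult (path_algebra Q) c = Poly_Mapping.map ((*) c)"
  by (simp_all add: path_algebra_def)

context fin_digraph
begin

lemma ring_path_algebra: "ring (path_algebra G :: ('k::field, _) module)"
proof (rule ringI)
  show "abelian_group (path_algebra G :: ('k, _) module)"
  proof (rule abelian_groupI)
    fix x y :: "('a, 'b) quiver_path \<Rightarrow>\<^sub>0 'k"
    assume "x \<in> carrier (path_algebra G)" "y \<in> carrier (path_algebra G)"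
    then show "x \<oplus>\<^bsub>path_algebra G\<^esub> y \<in> carrier (path_algebra G)"
      using keys_add[of x y] by auto
  next
    fix x :: "('a, 'b) quiver_path \<Rightarrow>\<^sub>0 'k"
    assume "x \<in> carrier (path_algebra G)"
    then show "\<exists>y\<in>carrier (path_algebra G). y \<oplus>\<^bsub>path_algebra G\<^esub> x = \<zero>\<^bsub>path_algebra G\<^esub>"
      by (intro bexI[of _ "- x"]) (auto simp: in_keys_iff)
  qed (simp_all add: add.assoc add.commute)
next
  show "Group.monoid (path_algebra G :: ('k, _) module)"
  proof (rule monoidI)
    show "\<one>\<^bsub>path_algebra G\<^esub> \<in> carrier (path_algebra G :: ('k, _) module)"
      by (auto dest!: subsetD[OF keys_sum])
  next
    fix x :: "('a, 'b) quiver_path \<Rightarrow>\<^sub>0 'k"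
    assume x: "x \<in> carrier (path_algebra G)"
    show "\<one>\<^bsub>path_algebra G\<^esub> \<otimes>\<^bsub>path_algebra G\<^esub> x = x"
      using x quiver_paths_verts
      by (auto intro!: poly_mapping_eqI simp: lookup_path_mult_vertices in_keys_iff)
    show "x \<otimes>\<^bsub>path_algebra G\<^esub> \<one>\<^bsub>path_algebra G\<^esub> = x"
      using x quiver_paths_verts
      by (auto intro!: poly_mapping_eqI simp: lookup_path_mult_vertices in_keys_iff)
  qed (simp_all add: path_mult_assoc path_mult_closed)
qed (simp_all add: path_mult_add_left path_mult_add_right)

lemma k_algebra_path_algebra: "k_algebra (path_algebra G :: ('k::field, _) module)"
proof -
  interpret ring "path_algebra G :: ('k, _) module" by (rule ring_path_algebra)
  show ?thesis
    by unfold_locales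
      (auto simp: map_times_add map_times_add_scalar path_mult_map_times
        intro!: poly_mapping_eqI dest!: subsetD[OF keys_map_times])
qed

end

section \<open>Quotient algebras and Morita equivalence\<close>

text \<open>\<open>A Quot I\<close> and \<open>quotient_algebra A I\<close> agree in all ring fields
  but are records of different types, so the ring laws are carried over field by field.\<close>

lemma ring_cong:
  assumes "ring R" "carrier S = carrier R" "monoid.mult S = monoid.mult R" "one S = one R"
    "zero S = zero R" "add S = add R"
  shows "ring S"
proof -
  interpret R: ring R by fact
  show ?thesis
    by (intro ringI abelian_groupI monoidI)
      (use R.add.inv_closed R.l_neg in \<open>auto simp: assms R.a_ac R.m_assoc R.l_distr R.r_distr\<close>)
qed

lemma quotient_algebra_simps [simp]:
  "carrier (quotient_algebra A I) = carrier (A Quot I)"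
  "monoid.mult (quotient_algebra A I) = monoid.mult (A Quot I)"
  "one (quotient_algebra A I) = one (A Quot I)"
  "zero (quotient_algebra A I) = zero (A Quot I)"
  "add (quotient_algebra A I) = add (A Quot I)"
  by (simp_all add: quotient_algebra_def ring.extend_def)

lemma quotient_algebra_zero: "zero (quotient_algebra A I) = I"
  by (simp add: FactRing_def)

lemma ring_hom_quotient_algebra_iff:
  "h \<in> ring_hom R (quotient_algebra A I) \<longleftrightarrow> h \<in> ring_hom R (A Quot I)"
  by (simp add: ring_hom_def)

lemma ring_iso_quotient_algebra_iff:
  "h \<in> ring_iso (quotient_algebra A I) S \<longleftrightarrow> h \<in> ring_iso (A Quot I) S"
  by (simp add: ring_iso_def ring_hom_def)

context k_algebra
begin

lemma smult_zero_right [simp]: "c \<odot> \<zero> = \<zero>"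
proof -
  have "c \<odot> \<zero> \<oplus> c \<odot> \<zero> = c \<odot> \<zero>" using smult_r_distr[of \<zero> \<zero> c] by simp
  then show ?thesis using smult_closed[of \<zero> c] by (simp add: add.r_cancel_one)
qed

lemma smult_zero_left [simp]: "x \<in> carrier A \<Longrightarrow> 0 \<odot> x = \<zero>"
proof -
  assume x: "x \<in> carrier A"
  then have "0 \<odot> x \<oplus> 0 \<odot> x = 0 \<odot> x" using smult_l_distr[of x 0 0] by simp
  then show ?thesis using smult_closed[of x 0] x by (simp add: add.r_cancel_one)
qed

text \<open>A two-sided ideal of a unital algebra is a subspace because
  \<open>c x = (c 1) x\<close>.\<close>

lemma ideal_smult_closed:
  assumes "ideal I A" "x \<in> I"
  shows "c \<odot> x \<in> I"
proof -
  interpret ideal I A by fact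
  have "(c \<odot> \<one>) \<otimes> x \<in> I" using assms(2) by (intro I_l_closed smult_closed) auto
  then show ?thesis using a_Hcarr[OF assms(2)] by (simp add: smult_mult_l)
qed

lemma quotient_algebra_smult:
  assumes "ideal I A" "x \<in> carrier A"
  shows "c \<odot>\<^bsub>quotient_algebra A I\<^esub> (I +> x) = I +> (c \<odot> x)"
proof -
  interpret I: ideal I A by fact
  \<comment> \<open>All members of the union in the definition are the same coset: two
    representatives differ by some \<open>i\<close> in \<open>I\<close>, and \<open>c\<close> times
    \<open>i\<close> stays in \<open>I\<close>.\<close>
  have *: "I +> (c \<odot> y) = I +> (c \<odot> x)" if "y \<in> I +> x" for y
  proof -
    from that obtain i where i: "i \<in> I" "y = i \<oplus> x" by (auto simp: a_r_coset_def')
    have "c \<odot> y = (c \<odot> i) \<oplus> (c \<odot> x)"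
      using i assms(2) I.a_Hcarr by (simp add: smult_r_distr)
    also have "I +> \<dots> = (I +> (c \<odot> i)) \<oplus>\<^bsub>A Quot I\<^esub> (I +> (c \<odot> x))"
      using i assms(2) I.a_Hcarr by (intro ring_hom_add[OF I.rcos_ring_hom] smult_closed)
    also have "I +> (c \<odot> i) = \<zero>\<^bsub>A Quot I\<^esub>"
      using ideal_smult_closed[OF assms(1) i(1)] by (simp add: I.a_rcos_const FactRing_def)
    also have "\<zero>\<^bsub>A Quot I\<^esub> \<oplus>\<^bsub>A Quot I\<^esub> (I +> (c \<odot> x)) = I +> (c \<odot> x)"
      using assms(2) smult_closed
      by (intro abelian_monoid.l_zero abelian_group.axioms(1) ring.is_abelian_group I.quotient_is_ring
        ring_hom_closed[OF I.rcos_ring_hom])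
    finally show ?thesis .
  qed
  have "x \<in> I +> x" using assms(2) by (rule I.a_rcos_self)
  then have "(\<Union>y\<in>I +> x. I +> (c \<odot> y)) = I +> (c \<odot> x)" using * by blast
  then show ?thesis by (simp add: quotient_algebra_def ring.extend_def module.fields_def)
qed

lemma ring_quotient_algebra: "ideal I A \<Longrightarrow> ring (quotient_algebra A I)"
  by (rule ring_cong[OF ideal.quotient_is_ring]) auto

lemma coset_ring_hom: "ideal I A \<Longrightarrow> ring_hom_ring A (quotient_algebra A I) ((+>) I)"
  by (intro ring_hom_ringI2 ring_axioms ring_quotient_algebra)
    (simp_all add: ring_hom_quotient_algebra_iff ideal.rcos_ring_hom)

lemma carrier_quotient_algebra: "carrier (quotient_algebra A I) = (+>) I ` carrier A"
  by (auto simp: FactRing_simps)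

lemma k_algebra_quotient_algebra:
  assumes "ideal I A"
  shows "k_algebra (quotient_algebra A I)"
proof -
  interpret h: ring_hom_ring A "quotient_algebra A I" "(+>) I"
    by (rule coset_ring_hom[OF assms])
  note q = quotient_algebra_smult[OF assms]
  let ?B = "quotient_algebra A I"
  have rep: "\<exists>x\<in>carrier A. X = I +> x" if "X \<in> carrier ?B" for X
    using that unfolding carrier_quotient_algebra by blast
  have add: "(I +> x) \<oplus>\<^bsub>?B\<^esub> (I +> y) = I +> (x \<oplus> y)"
    and mult: "(I +> x) \<otimes>\<^bsub>?B\<^esub> (I +> y) = I +> (x \<otimes> y)" if "x \<in> carrier A" "y \<in> carrier A" for x y
    using that h.hom_add h.hom_mult by metis+
  note simps = add mult q smult_closed smult_l_distr smult_r_distr smult_assoc smult_one smult_mult_l smult_mult_r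
  show ?thesis
  proof (intro k_algebra.intro h.S.ring_axioms k_algebra_axioms.intro)
    fix X c assume "X \<in> carrier ?B"
    then obtain x where x: "x \<in> carrier A" "X = I +> x" using rep by blast
    show "c \<odot>\<^bsub>?B\<^esub> X \<in> carrier ?B"
      unfolding carrier_quotient_algebra x(2) using x(1) by (simp only: simps) (blast intro: smult_closed)
    show "1 \<odot>\<^bsub>?B\<^esub> X = X"
      unfolding x(2) using x(1) by (simp only: simps)
    fix d
    show "(c + d) \<odot>\<^bsub>?B\<^esub> X = c \<odot>\<^bsub>?B\<^esub> X \<oplus>\<^bsub>?B\<^esub> d \<odot>\<^bsub>?B\<^esub> X"
      unfolding x(2) using x(1) by (simp only: simps)
    show "(c * d) \<odot>\<^bsub>?B\<^esub> X = c \<odot>\<^bsub>?B\<^esub> (d \<odot>\<^bsub>?B\<^esub> X)"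
      unfolding x(2) using x(1) by (simp only: simps)
  next
    fix X Y c assume "X \<in> carrier ?B" "Y \<in> carrier ?B"
    then obtain x y where x: "x \<in> carrier A" "X = I +> x" and y: "y \<in> carrier A" "Y = I +> y"
      using rep by meson
    have c: "x \<oplus> y \<in> carrier A" "x \<otimes> y \<in> carrier A" using x y by auto
    show "c \<odot>\<^bsub>?B\<^esub> (X \<oplus>\<^bsub>?B\<^esub> Y) = c \<odot>\<^bsub>?B\<^esub> X \<oplus>\<^bsub>?B\<^esub> c \<odot>\<^bsub>?B\<^esub> Y"
      unfolding x(2) y(2) using x(1) y(1) c by (simp only: simps)
    show "c \<odot>\<^bsub>?B\<^esub> X \<otimes>\<^bsub>?B\<^esub> Y = c \<odot>\<^bsub>?B\<^esub> (X \<otimes>\<^bsub>?B\<^esub> Y)"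
      unfolding x(2) y(2) using x(1) y(1) c by (simp only: simps)
    show "X \<otimes>\<^bsub>?B\<^esub> (c \<odot>\<^bsub>?B\<^esub> Y) = c \<odot>\<^bsub>?B\<^esub> (X \<otimes>\<^bsub>?B\<^esub> Y)"
      unfolding x(2) y(2) using x(1) y(1) c by (simp only: simps)
  qed
qed

text \<open>First isomorphism theorem for the composite of \<open>h\<close> with the projection
  modulo \<open>J\<close>, whose kernel is \<open>I\<close>.\<close>

lemma quotient_algebra_iso:
  assumes B: "k_algebra B" and h: "h \<in> ring_hom A B" "h ` carrier A = carrier B"
    and linear: "\<And>c x. x \<in> carrier A \<Longrightarrow> h (c \<odot> x) = c \<odot>\<^bsub>B\<^esub> h x"
    and J: "ideal J B" and I: "I = {x \<in> carrier A. h x \<in> J}"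
  shows "algebra_iso (quotient_algebra A I) (quotient_algebra B J)"
proof -
  interpret B: k_algebra B by fact
  interpret J: ideal J B by fact
  interpret h: ring_hom_ring A B h by (intro ring_hom_ringI2 ring_axioms B.ring_axioms h)
  interpret q: ring_hom_ring B "quotient_algebra B J" "(+>\<^bsub>B\<^esub>) J"
    by (rule B.coset_ring_hom[OF J])
  define g where "g = (\<lambda>x. J +>\<^bsub>B\<^esub> h x)"
  have carr: "h x \<in> carrier B" if "x \<in> carrier A" for x using that by simp
  have "g \<in> ring_hom A (quotient_algebra B J)"
    unfolding g_def using ring_hom_trans[OF h(1) q.homh] by (simp add: comp_def)
  then interpret g: ring_hom_ring A "quotient_algebra B J" g
    by (rule ring_hom_ringI2[OF ring_axioms q.S.ring_axioms])
  have ker: "a_kernel A (quotient_algebra B J) g = I"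
  proof -
    have "J +>\<^bsub>B\<^esub> h x = J \<longleftrightarrow> h x \<in> J" if "x \<in> carrier A" for x
      using J.a_rcos_const[of "h x"] J.a_rcos_self[OF carr[OF that]] by blast
    then show ?thesis unfolding I a_kernel_def' g_def quotient_algebra_zero by blast
  qed
  have surj: "g ` carrier A = carrier (quotient_algebra B J)"
    unfolding B.carrier_quotient_algebra g_def h(2)[symmetric] image_image ..
  note iso = g.FactRing_iso_set[OF surj, unfolded ker]
  \<comment> \<open>\<open>g\<close> is constant on cosets of \<open>I\<close>, so the image of a
    coset is a singleton and \<open>the_elem\<close> picks its value.\<close>
  let ?f = "\<lambda>X. the_elem (g ` X)"
  have idI: "ideal I A" using g.kernel_is_ideal ker by simp
  have "?f (c \<odot>\<^bsub>quotient_algebra A I\<^esub> X) = c \<odot>\<^bsub>quotient_algebra B J\<^esub> ?f X"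
    if "X \<in> carrier (quotient_algebra A I)" for c X
  proof -
    from that obtain x where x: "x \<in> carrier A" "X = I +> x"
      unfolding carrier_quotient_algebra by auto
    have the: "?f (I +> y) = g y" if "y \<in> carrier A" for y
      using g.the_elem_simp[OF that] ker by simp
    have "?f (c \<odot>\<^bsub>quotient_algebra A I\<^esub> X) = g (c \<odot> x)"
      unfolding x(2) quotient_algebra_smult[OF idI x(1)] by (rule the[OF smult_closed[OF x(1)]])
    also have "\<dots> = c \<odot>\<^bsub>quotient_algebra B J\<^esub> g x"
      unfolding g_def linear[OF x(1)] by (rule B.quotient_algebra_smult[OF J carr[OF x(1)], symmetric])
    finally show ?thesis unfolding x(2) the[OF x(1)] .
  qed
  moreover have "?f \<in> ring_iso (quotient_algebra A I) (quotient_algebra B J)"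
    using iso unfolding ring_iso_quotient_algebra_iff .
  ultimately show ?thesis unfolding algebra_iso_def by (intro bexI[of _ ?f] allI ballI)
qed

text \<open>Spanning is expressed through sets \<open>W\<close> closed under the linear operations,
  which permits induction over the carrier. Taking for \<open>W\<close> the linear combinations of
  \<open>B\<close> recovers the definition.\<close>

lemma finite_dimensionalI:
  assumes B: "finite B" "B \<subseteq> carrier A"
    and span: "\<And>W. \<lbrakk>\<zero> \<in> W; \<And>b c. b \<in> B \<Longrightarrow> c \<odot> b \<in> W; \<And>x y. x \<in> W \<Longrightarrow> y \<in> W \<Longrightarrow> x \<oplus> y \<in> W\<rbrakk>
        \<Longrightarrow> carrier A \<subseteq> W"
  shows "finite_dimensional A"
proof -
  define W where "W = {x. \<exists>c. x = (\<Oplus>b\<in>B. c b \<odot> b)}"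
  have "carrier A \<subseteq> W"
  proof (rule span)
    have "\<zero> = (\<Oplus>b\<in>B. 0 \<odot> b)"
      using B by (auto intro!: add.finprod_one_eqI[symmetric])
    then show "\<zero> \<in> W" unfolding W_def by (intro CollectI exI[of _ "\<lambda>_. 0"])
  next
    fix b c assume b: "b \<in> B"
    have "(\<Oplus>b'\<in>B. (if b' = b then c else 0) \<odot> b') = (\<Oplus>b'\<in>B. if b = b' then c \<odot> b' else \<zero>)"
      using B by (intro finsum_cong') (auto simp: smult_closed)
    also have "\<dots> = c \<odot> b"
      using B b by (intro finsum_singleton) (auto simp: smult_closed)
    finally show "c \<odot> b \<in> W"
      unfolding W_def by (intro CollectI exI[of _ "\<lambda>b'. if b' = b then c else 0"]) simp
  next
    fix x y assume "x \<in> W" "y \<in> W"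
    then obtain c d where cd: "x = (\<Oplus>b\<in>B. c b \<odot> b)" "y = (\<Oplus>b\<in>B. d b \<odot> b)" unfolding W_def by auto
    have "(\<Oplus>b\<in>B. (c b + d b) \<odot> b) = (\<Oplus>b\<in>B. c b \<odot> b \<oplus> d b \<odot> b)"
      using B by (intro finsum_cong') (auto simp: smult_closed smult_l_distr)
    also have "\<dots> = x \<oplus> y"
      unfolding cd using B by (intro finsum_addf) (auto simp: smult_closed)
    finally show "x \<oplus> y \<in> W"
      unfolding W_def by (intro CollectI exI[of _ "\<lambda>b. c b + d b"]) simp
  qed
  then show ?thesis unfolding finite_dimensional_def W_def using B by blast
qed

end

text \<open>The carrier is unchanged, so along an isomorphism \<open>h\<close> the homomorphisms
  between restricted modules are the same functions and the functor can act on them as the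
  identity.\<close>

definition restrict_scalars :: "('x \<Rightarrow> 'y) \<Rightarrow> ('y, 'm) module \<Rightarrow> ('x, 'm) module" where
  "restrict_scalars h M =
     \<lparr>carrier = carrier M, monoid.mult = monoid.mult M, one = one M, ring.zero = zero M, add = add M,
      smult = (\<lambda>a x. h a \<odot>\<^bsub>M\<^esub> x)\<rparr>"

lemma restrict_scalars_simps [simp]:
  "carrier (restrict_scalars h M) = carrier M"
  "zero (restrict_scalars h M) = zero M"
  "add (restrict_scalars h M) = add M"
  "smult (restrict_scalars h M) a x = h a \<odot>\<^bsub>M\<^esub> x"
  by (simp_all add: restrict_scalars_def)

lemma finsum_restrict_scalars: "finsum (restrict_scalars h M) f B = finsum M f B"
  by (simp add: finsum_def finprod_def)

lemma abelian_group_restrict_scalars: "abelian_group M \<Longrightarrow> abelian_group (restrict_scalars h M)"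
  by (rule abelian_groupI) (auto dest: abelian_groupE)

lemma fg_modules_restrict_scalars:
  assumes h: "h \<in> ring_iso A B" and A: "ring A" and M: "M \<in> fg_modules B"
  shows "restrict_scalars h M \<in> fg_modules A"
proof -
  have B: "ring B" and mod: "left_module B M" and fg: "finitely_generated B M"
    using M by (auto simp: fg_modules_def left_module_def)
  note ho = ring_iso_memE[OF h]
  have bij: "bij_betw h (carrier A) (carrier B)" using h by (simp add: ring_iso_def)
  have "left_module A (restrict_scalars h M)"
    using mod A unfolding left_module_def
    by (simp add: abelian_group_restrict_scalars ho)
  moreover have "finitely_generated A (restrict_scalars h M)"
  proof -
    from fg obtain G where G: "finite G" "G \<subseteq> carrier M"
      "\<forall>x\<in>carrier M. \<exists>c\<in>(Pi G (\<lambda>_. carrier B)). x = (\<Oplus>\<^bsub>M\<^esub>g\<in>G. c g \<odot>\<^bsub>M\<^esub> g)"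
      unfolding finitely_generated_def by auto
    have "\<exists>c\<in>(Pi G (\<lambda>_. carrier A)). x = (\<Oplus>\<^bsub>M\<^esub>g\<in>G. h (c g) \<odot>\<^bsub>M\<^esub> g)" if x: "x \<in> carrier M" for x
    proof -
      from G(3) x obtain c where c: "c \<in> Pi G (\<lambda>_. carrier B)" "x = (\<Oplus>\<^bsub>M\<^esub>g\<in>G. c g \<odot>\<^bsub>M\<^esub> g)" by blast
      \<comment> \<open>The same generators work; coefficients in \<open>B\<close> are replaced by
        their preimages under \<open>h\<close>.\<close>
      let ?k = "inv_into (carrier A) h"
      have k: "?k (c g) \<in> carrier A" "h (?k (c g)) = c g" if "g \<in> G" for g
        using c(1) that bij by (force simp: bij_betw_def intro: inv_into_into, force simp: bij_betw_def intro: f_inv_into_f)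
      interpret abelian_group M using mod by (simp add: left_module_def)
      have "x = (\<Oplus>\<^bsub>M\<^esub>g\<in>G. h (?k (c g)) \<odot>\<^bsub>M\<^esub> g)"
        unfolding c(2) using c(1) G(2) mod
        by (intro finsum_cong') (auto simp: k left_module_def Pi_iff)
      then show ?thesis by (intro bexI[of _ "\<lambda>g. ?k (c g)"]) (auto simp: k)
    qed
    with G(1,2) show ?thesis
      unfolding finitely_generated_def by (auto simp: finsum_restrict_scalars)
  qed
  ultimately show ?thesis by (simp add: fg_modules_def)
qed

text \<open>Because \<open>h\<close> is onto, linearity over \<open>B\<close> and over
  \<open>A\<close> are the same condition.\<close>

lemma module_hom_restrict_scalars:
  assumes "h \<in> ring_iso A B"
  shows "module_hom A (restrict_scalars h M) (restrict_scalars h N) = module_hom B M N"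
proof -
  have "h ` carrier A = carrier B" using assms by (simp add: ring_iso_def bij_betw_def)
  then have "\<And>P. (\<forall>b\<in>carrier B. P b) \<longleftrightarrow> (\<forall>a\<in>carrier A. P (h a))" by force
  then show ?thesis unfolding module_hom_def by simp
qed

text \<open>Restriction along \<open>h\<close> turns \<open>B\<close>-modules into
  \<open>A\<close>-modules, whence the order in the conclusion. It is the identity on homomorphisms,
  and it is linear over the field since \<open>h\<close> sends \<open>c 1\<close> to
  \<open>c 1\<close>.\<close>

lemma algebra_iso_imp_morita_equivalent:
  assumes iso: "algebra_iso A B" and A: "k_algebra A" and B: "k_algebra B"
  shows "morita_equivalent B A"
proof -
  interpret A: k_algebra A by fact
  interpret B: k_algebra B by fact
  from iso obtain h where h: "h \<in> ring_iso A B"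
    and lin: "\<And>c x. x \<in> carrier A \<Longrightarrow> h (c \<odot>\<^bsub>A\<^esub> x) = c \<odot>\<^bsub>B\<^esub> h x"
    unfolding algebra_iso_def by blast
  let ?k = "inv_into (carrier A) h"
  have k: "?k \<in> ring_iso B A" using ring_iso_set_sym[OF A.ring_axioms h] .
  have hk: "h (?k b) = b" if "b \<in> carrier B" for b
    using h that by (auto simp: ring_iso_def bij_betw_def intro: f_inv_into_f)
  have one: "h (c \<odot>\<^bsub>A\<^esub> \<one>\<^bsub>A\<^esub>) = c \<odot>\<^bsub>B\<^esub> \<one>\<^bsub>B\<^esub>" for c
    using ring_iso_memE(4)[OF h] by (simp add: lin)
  have fgA: "restrict_scalars h M \<in> fg_modules A" if "M \<in> fg_modules B" for M
    using fg_modules_restrict_scalars[OF h A.ring_axioms that] .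
  \<comment> \<open>Restricting along the inverse and then along \<open>h\<close> returns
    \<open>N\<close> only up to isomorphism, as the records may differ in the action of elements
    outside \<open>carrier A\<close>. The identity map is the isomorphism.\<close>
  have ess: "\<exists>M\<in>fg_modules B. \<exists>f\<in>module_hom A (restrict_scalars h M) N.
          bij_betw f (carrier (restrict_scalars h M)) (carrier N)" if N: "N \<in> fg_modules A" for N
  proof (intro bexI)
    show "restrict_scalars ?k N \<in> fg_modules B"
      by (rule fg_modules_restrict_scalars[OF k B.ring_axioms N])
    have kh: "?k (h a) = a" if "a \<in> carrier A" for a
      using h that by (auto simp: ring_iso_def bij_betw_def)
    show "(\<lambda>x\<in>carrier N. x) \<in> module_hom A (restrict_scalars h (restrict_scalars ?k N)) N"
      using N unfolding module_hom_def fg_modules_def left_module_def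
      by (auto simp: kh dest: abelian_groupE)
    show "bij_betw (\<lambda>x\<in>carrier N. x) (carrier (restrict_scalars h (restrict_scalars ?k N))) (carrier N)"
      by (auto simp: bij_betw_def inj_on_def)
  qed
  have "module_equivalence B A (restrict_scalars h) (\<lambda>M N f. f)"
    unfolding module_equivalence_def using fgA ess
    by (auto simp: module_hom_restrict_scalars[OF h] one bij_betw_def)
  then show ?thesis unfolding morita_equivalent_def by blast
qed

section \<open>Admissible ideals\<close>

text \<open>Negatives come from multiplication by the negative of the unit.\<close>

lemma (in ring) idealI_mult_closed:
  assumes "S \<subseteq> carrier R" "\<zero> \<in> S" "\<And>x y. \<lbrakk>x \<in> S; y \<in> S\<rbrakk> \<Longrightarrow> x \<oplus> y \<in> S"
    and l: "\<And>x r. \<lbrakk>x \<in> S; r \<in> carrier R\<rbrakk> \<Longrightarrow> r \<otimes> x \<in> S"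
    and "\<And>x r. \<lbrakk>x \<in> S; r \<in> carrier R\<rbrakk> \<Longrightarrow> x \<otimes> r \<in> S"
  shows "ideal S R"
proof (rule idealI[OF ring_axioms])
  show "subgroup S (add_monoid R)"
  proof (rule add.subgroupI)
    fix x assume x: "x \<in> S"
    have "\<ominus> x = (\<ominus> \<one>) \<otimes> x" using x assms(1) by (auto simp: l_minus)
    then show "\<ominus> x \<in> S" using l[OF x] by simp
  qed (use assms in auto)
qed (use assms in auto)

text \<open>For a finite quiver this is the \<open>m\<close>-th power of the arrow ideal, turned
  into a condition on supports.\<close>

definition long_paths :: "('v, 'a) pre_digraph \<Rightarrow> nat \<Rightarrow> (('v, 'a) quiver_path \<Rightarrow>\<^sub>0 'k::field) set" where
  "long_paths Q m = {f. Poly_Mapping.keys f \<subseteq> {p \<in> quiver_paths Q. m \<le> length (snd p)}}"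

lemma long_paths_antimono: "m \<le> n \<Longrightarrow> long_paths Q n \<subseteq> long_paths Q m"
  unfolding long_paths_def by fastforce

lemma arrow_elem_mult:
  "path_mult Q (arrow_elem Q a) (arrow_elem Q b) = (if head Q a = tail Q b then path_elem Q [a, b] else 0)"
  by (simp add: arrow_elem_def path_elem_def path_mult_single path_target_simp)

context fin_digraph
begin

text \<open>Negatives in the ring structure are given by a description over the carrier; uniqueness
  of solutions identifies the resulting difference with the pointwise one.\<close>

lemma path_algebra_minus:
  fixes x :: "_ \<Rightarrow>\<^sub>0 'k::field"
  assumes "x \<in> carrier (path_algebra G)" "y \<in> carrier (path_algebra G)"
  shows "x \<ominus>\<^bsub>path_algebra G\<^esub> y = x - y"
proof -
  interpret ring "path_algebra G :: ('k, _) module" by (rule ring_path_algebra)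
  have "(x - y) \<oplus>\<^bsub>path_algebra G\<^esub> y = x" by simp
  moreover have "x - y \<in> carrier (path_algebra G)"
    using assms by (auto dest!: subsetD[OF keys_diff])
  ultimately show ?thesis using assms by (metis a_minus_def add.inv_closed add.inv_solve_right)
qed

lemma path_idealD:
  assumes "ideal I (path_algebra G)"
  shows "I \<subseteq> carrier (path_algebra G)"
    and "0 \<in> I"
    and "\<And>x y. \<lbrakk>x \<in> I; y \<in> I\<rbrakk> \<Longrightarrow> x + y \<in> I"
    and "\<And>x y. \<lbrakk>x \<in> I; y \<in> I\<rbrakk> \<Longrightarrow> x - y \<in> I"
    and "\<And>x y. \<lbrakk>x \<in> I; Poly_Mapping.keys y \<subseteq> quiver_paths G\<rbrakk> \<Longrightarrow> path_mult G x y \<in> I"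
    and "\<And>x y. \<lbrakk>x \<in> I; Poly_Mapping.keys y \<subseteq> quiver_paths G\<rbrakk> \<Longrightarrow> path_mult G y x \<in> I"
    and "\<And>x c. x \<in> I \<Longrightarrow> Poly_Mapping.map ((*) c) x \<in> I"
proof -
  interpret ideal I "path_algebra G" by fact
  show sub: "I \<subseteq> carrier (path_algebra G)" by (rule a_subset)
  show "0 \<in> I" using additive_subgroup.zero_closed[OF additive_subgroup_axioms] by simp
  show "x + y \<in> I" if "x \<in> I" "y \<in> I" for x y
    using additive_subgroup.a_closed[OF additive_subgroup_axioms that] by simp
  show "x - y \<in> I" if "x \<in> I" "y \<in> I" for x y
  proof -
    have "x \<oplus>\<^bsub>path_algebra G\<^esub> \<ominus>\<^bsub>path_algebra G\<^esub> y \<in> I"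
      using that by (intro additive_subgroup.a_closed[OF additive_subgroup_axioms]
        additive_subgroup.a_inv_closed[OF additive_subgroup_axioms])
    then show ?thesis
      using path_algebra_minus[of x y] subsetD[OF sub that(1)] subsetD[OF sub that(2)]
      unfolding a_minus_def by simp
  qed
  show "path_mult G x y \<in> I" if "x \<in> I" "Poly_Mapping.keys y \<subseteq> quiver_paths G" for x y
    using I_r_closed[of x y] that by simp
  show "path_mult G y x \<in> I" if "x \<in> I" "Poly_Mapping.keys y \<subseteq> quiver_paths G" for x y
    using I_l_closed[of x y] that by simp
  show "Poly_Mapping.map ((*) c) x \<in> I" if "x \<in> I" for x c
    using k_algebra.ideal_smult_closed[OF k_algebra_path_algebra assms that, of c] by simp
qed

text \<open>\<open>I\<close> is a subspace, so it is enough that it contains the single paths in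
  \<open>X\<close>.\<close>

lemma path_ideal_spanI:
  assumes I: "ideal I (path_algebra G)" and "Poly_Mapping.keys f \<subseteq> X"
    and X: "\<And>p. p \<in> X \<Longrightarrow> Poly_Mapping.single p 1 \<in> I"
  shows "f \<in> I"
  using assms(2)
proof (induction f rule: poly_mapping_span_induct)
  case (single p c)
  then show ?case
    using path_idealD(7)[OF I X[OF single], of c] by (simp add: map_times_single)
qed (use path_idealD[OF I] in auto)

lemma path_ideal_appendI:
  assumes I: "ideal I (path_algebra G)" and q: "Poly_Mapping.single (v, q) 1 \<in> I"
    and p: "(u, xs @ q @ ys) \<in> quiver_paths G" and v: "path_target G (u, xs) = v"
  shows "Poly_Mapping.single (u, xs @ q @ ys) 1 \<in> I"
proof -
  have xs: "(u, xs) \<in> quiver_paths G" and qys: "(v, q @ ys) \<in> quiver_paths G"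
    using quiver_paths_appendD[OF p] v by auto
  have ys: "(path_target G (v, q), ys) \<in> quiver_paths G" using quiver_paths_appendD[OF qys] by auto
  have "path_mult G (Poly_Mapping.single (u, xs) 1)
      (path_mult G (Poly_Mapping.single (v, q) 1) (Poly_Mapping.single (path_target G (v, q), ys) 1)) \<in> I"
    using q xs ys by (intro path_idealD(5,6)[OF I]) auto
  then show ?thesis using v by (simp add: path_mult_single)
qed

lemma path_mult_long_paths:
  assumes f: "f \<in> long_paths G m" and g: "g \<in> long_paths G n"
  shows "path_mult G f g \<in> long_paths G (m + n)"
proof -
  have "m + n \<le> length (snd r)" if "r \<in> Poly_Mapping.keys (path_mult G f g)" for r
  proof -
    from subsetD[OF keys_path_mult that] obtain p q
      where r: "r = (fst p, snd p @ snd q)" and p: "p \<in> Poly_Mapping.keys f" and q: "q \<in> Poly_Mapping.keys g"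
      by blast
    have "m \<le> length (snd p)" "n \<le> length (snd q)"
      using f g p q unfolding long_paths_def by blast+
    then show ?thesis by (simp add: r)
  qed
  moreover have "Poly_Mapping.keys (path_mult G f g) \<subseteq> quiver_paths G"
    using f g by (intro path_mult_closed) (auto simp: long_paths_def)
  ultimately show ?thesis unfolding long_paths_def by blast
qed

lemma long_paths_0: "long_paths G 0 = carrier (path_algebra G)"
  by (simp add: long_paths_def)

lemma ideal_long_paths: "ideal (long_paths G m) (path_algebra G :: ('k::field, _) module)"
proof -
  interpret ring "path_algebra G :: ('k, _) module" by (rule ring_path_algebra)
  show ?thesis
  proof (rule idealI_mult_closed)
    fix x y :: "('a, 'b) quiver_path \<Rightarrow>\<^sub>0 'k" assume "x \<in> long_paths G m" "y \<in> long_paths G m"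
    then show "x \<oplus>\<^bsub>path_algebra G\<^esub> y \<in> long_paths G m"
      using keys_add[of x y] by (auto simp: long_paths_def)
  next
    fix x r :: "('a, 'b) quiver_path \<Rightarrow>\<^sub>0 'k"
    assume "x \<in> long_paths G m" "r \<in> carrier (path_algebra G)"
    then show "r \<otimes>\<^bsub>path_algebra G\<^esub> x \<in> long_paths G m" "x \<otimes>\<^bsub>path_algebra G\<^esub> r \<in> long_paths G m"
      unfolding long_paths_0[symmetric]
      using path_mult_long_paths[of r 0 x m] path_mult_long_paths[of x m r 0] by simp_all
  qed (auto simp: long_paths_def)
qed

text \<open>A nonempty path is its first arrow followed by the rest, so it lies in every ideal that
  contains the arrows.\<close>

lemma arrow_ideal_eq: "arrow_ideal G = (long_paths G 1 :: (_ \<Rightarrow>\<^sub>0 'k::field) set)"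
  (is "?J = ?L")
proof
  interpret ring "path_algebra G :: ('k, _) module" by (rule ring_path_algebra)
  have arr: "arrow_elem G ` arcs G \<subseteq> ?L"
    by (auto simp: arrow_elem_def path_elem_def long_paths_def quiver_paths_Cons)
  then show "?J \<subseteq> ?L"
    unfolding arrow_ideal_def by (intro genideal_minimal ideal_long_paths)
  have sub: "arrow_elem G ` arcs G \<subseteq> carrier (path_algebra G :: ('k, _) module)"
    using arr by (auto simp: long_paths_def)
  have I: "ideal ?J (path_algebra G)"
    unfolding arrow_ideal_def using sub by (rule genideal_ideal)
  show "?L \<subseteq> ?J"
  proof
    fix f :: "('a, 'b) quiver_path \<Rightarrow>\<^sub>0 'k" assume "f \<in> long_paths G 1"
    then have "Poly_Mapping.keys f \<subseteq> {p \<in> quiver_paths G. 1 \<le> length (snd p)}" by (simp add: long_paths_def)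
    then show "f \<in> arrow_ideal G"
    proof (rule path_ideal_spanI[OF I])
      fix p assume p: "p \<in> {p \<in> quiver_paths G. 1 \<le> length (snd p)}"
      then obtain u a q where pe: "p = (u, a # q)" by (cases p; cases "snd p") auto
      then have a: "a \<in> arcs G" "u = tail G a" "(u, [] @ [a] @ q) \<in> quiver_paths G"
        using p by (auto simp: quiver_paths_Cons)
      have "arrow_elem G a \<in> ?J"
        unfolding arrow_ideal_def using sub a(1) genideal_self by blast
      then have "Poly_Mapping.single (u, [] @ [a] @ q) 1 \<in> ?J"
        using a by (intro path_ideal_appendI[OF I]) (auto simp: arrow_elem_def path_elem_def path_target_simp)
      then show "Poly_Mapping.single p 1 \<in> ?J" by (simp add: pe)
    qed
  qed
qed

text \<open>Lengths add under concatenation; conversely, a path of length at least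
  \<open>Suc m\<close> splits into its first arrow and a path of length at least
  \<open>m\<close>.\<close>

lemma ideal_power_arrow_ideal:
  "ideal_power (path_algebra G) (arrow_ideal G) m = (long_paths G m :: (_ \<Rightarrow>\<^sub>0 'k::field) set)"
proof (induction m)
  case 0
  then show ?case by (auto simp: long_paths_def)
next
  case (Suc m)
  interpret ring "path_algebra G :: ('k, _) module" by (rule ring_path_algebra)
  have I: "ideal (ideal_prod (path_algebra G) (long_paths G 1) (long_paths G m)) (path_algebra G :: ('k, _) module)"
    by (intro ideal_prod_is_ideal ideal_long_paths)
  have "ideal_prod (path_algebra G) (long_paths G 1) (long_paths G m) =
      (long_paths G (Suc m) :: (_ \<Rightarrow>\<^sub>0 'k) set)"
  proof (intro equalityI subsetI)
    fix f :: "('a, 'b) quiver_path \<Rightarrow>\<^sub>0 'k"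
    assume "f \<in> ideal_prod (path_algebra G) (long_paths G 1) (long_paths G m)"
    then show "f \<in> long_paths G (Suc m)"
    proof induction
      case (prod i j)
      then show ?case using path_mult_long_paths[of i 1 j m] by simp
    next
      case (sum s1 s2)
      then show ?case using path_idealD(3)[OF ideal_long_paths] by simp
    qed
  next
    fix f :: "('a, 'b) quiver_path \<Rightarrow>\<^sub>0 'k" assume "f \<in> long_paths G (Suc m)"
    then have "Poly_Mapping.keys f \<subseteq> {p \<in> quiver_paths G. Suc m \<le> length (snd p)}" by (simp add: long_paths_def)
    then show "f \<in> ideal_prod (path_algebra G) (long_paths G 1) (long_paths G m)"
    proof (rule path_ideal_spanI[OF I])
      fix p assume p: "p \<in> {p \<in> quiver_paths G. Suc m \<le> length (snd p)}"
      then obtain u a q where pe: "p = (u, a # q)" by (cases p; cases "snd p") auto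
      then have a: "a \<in> arcs G" "u = tail G a" "(head G a, q) \<in> quiver_paths G" "m \<le> length q"
        using p by (auto simp: quiver_paths_Cons)
      have "Poly_Mapping.single (u, [a]) 1 \<otimes>\<^bsub>path_algebra G\<^esub> Poly_Mapping.single (head G a, q) 1
          \<in> ideal_prod (path_algebra G) (long_paths G 1) (long_paths G m)"
        using a by (intro ideal_prod.prod) (auto simp: long_paths_def quiver_paths_Cons)
      then show "Poly_Mapping.single p 1 \<in> ideal_prod (path_algebra G) (long_paths G 1) (long_paths G m)"
        by (simp add: pe path_mult_single path_target_simp)
    qed
  qed
  then show ?case unfolding ideal_power.simps Suc.IH by (simp only: arrow_ideal_eq)
qed

lemma admissible_ideal_iff:
  "admissible_ideal G I \<longleftrightarrow>
     ideal I (path_algebra G) \<and> I \<subseteq> long_paths G 2 \<and> (\<exists>m\<ge>2. long_paths G m \<subseteq> I)"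
  unfolding admissible_ideal_def ideal_power_arrow_ideal ..

lemma finite_quiver_paths_length: "finite {p \<in> quiver_paths G. length (snd p) < m}"
proof (rule finite_subset)
  show "{p \<in> quiver_paths G. length (snd p) < m} \<subseteq> verts G \<times> {p. set p \<subseteq> arcs G \<and> length p \<le> m}"
    using quiver_paths_verts(1) quiver_paths_arcs by fastforce
  show "finite (verts G \<times> {p. set p \<subseteq> arcs G \<and> length p \<le> m})"
    by (intro finite_cartesian_product finite_lists_length_le) auto
qed

text \<open>Once all paths of length at least \<open>m\<close> lie in \<open>I\<close>, the finitely
  many shorter ones span the quotient.\<close>

lemma finite_dimensional_quotient_path_algebra:
  assumes "admissible_ideal G I"
  shows "finite_dimensional (quotient_algebra (path_algebra G) I)"
proof -
  from assms obtain m where I: "ideal I (path_algebra G)" and m: "long_paths G m \<subseteq> I"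
    by (auto simp: admissible_ideal_iff)
  let ?A = "path_algebra G" and ?B = "quotient_algebra (path_algebra G) I"
  interpret A: k_algebra ?A by (rule k_algebra_path_algebra)
  interpret B: k_algebra ?B by (rule A.k_algebra_quotient_algebra[OF I])
  interpret h: ring_hom_ring ?A ?B "(+>\<^bsub>?A\<^esub>) I" by (rule A.coset_ring_hom[OF I])
  let ?P = "{p \<in> quiver_paths G. length (snd p) < m}"
  let ?q = "\<lambda>x. I +>\<^bsub>?A\<^esub> x"
  show ?thesis
  proof (rule B.finite_dimensionalI)
    show "finite ((\<lambda>p. ?q (Poly_Mapping.single p 1)) ` ?P)"
      by (intro finite_imageI finite_quiver_paths_length)
    show "(\<lambda>p. ?q (Poly_Mapping.single p 1)) ` ?P \<subseteq> carrier ?B"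
      unfolding A.carrier_quotient_algebra by (auto split: if_splits)
  next
    fix W
    assume W: "\<zero>\<^bsub>?B\<^esub> \<in> W"
      "\<And>b c. b \<in> (\<lambda>p. ?q (Poly_Mapping.single p 1)) ` ?P \<Longrightarrow> c \<odot>\<^bsub>?B\<^esub> b \<in> W"
      "\<And>x y. x \<in> W \<Longrightarrow> y \<in> W \<Longrightarrow> x \<oplus>\<^bsub>?B\<^esub> y \<in> W"
    have zero: "?q x \<in> W" if "x \<in> I" for x
      using that W(1) ideal.axioms(1)[OF I] abelian_subgroup.a_rcos_const
      by (metis I A.quotient_algebra_smult quotient_algebra_zero A.is_abelian_group abelian_subgroupI3)
    have "?q f \<in> W" if "Poly_Mapping.keys f \<subseteq> quiver_paths G" for f
      using that
    proof (induction f rule: poly_mapping_span_induct)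
      case zero
      then show ?case using path_idealD(2)[OF I] \<open>\<And>x. x \<in> I \<Longrightarrow> ?q x \<in> W\<close> by blast
    next
      case (single p c)
      have p: "Poly_Mapping.single p 1 \<in> carrier ?A" using single by simp
      have eq: "Poly_Mapping.single p c = c \<odot>\<^bsub>?A\<^esub> Poly_Mapping.single p 1" by (simp add: map_times_single)
      show ?case
      proof (cases "length (snd p) < m")
        case True
        then show ?thesis
          unfolding eq A.quotient_algebra_smult[OF I p, symmetric] using single by (intro W(2)) blast
      next
        case False
        then have "Poly_Mapping.single p c \<in> long_paths G m" using single by (auto simp: long_paths_def)
        then show ?thesis using m \<open>\<And>x. x \<in> I \<Longrightarrow> ?q x \<in> W\<close> by blast
      qed
    next
      case (add f g)
      then have "?q (f + g) = ?q f \<oplus>\<^bsub>?B\<^esub> ?q g"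
        using h.hom_add[of f g] by simp
      then show ?case using add.IH W(3) by metis
    qed
    then show "carrier ?B \<subseteq> W" unfolding A.carrier_quotient_algebra by auto
  qed
qed

text \<open>\<open>path_elem\<close> reads the source off the first arrow; as \<open>q\<close> is
  nonempty, this is the vertex at which \<open>q\<close> occurs inside \<open>p\<close>. Multiplying
  by the two flanking pieces then gives \<open>p\<close>.\<close>

lemma single_sublist_in_ideal:
  assumes I: "ideal I (path_algebra G)" and "path_elem G q \<in> I" "q \<noteq> []" "sublist q (snd p)"
    and p: "p \<in> quiver_paths G"
  shows "Poly_Mapping.single p 1 \<in> I"
proof -
  obtain u where pu: "p = (u, snd p)" by (metis prod.collapse)
  from assms obtain xs ys where xy: "snd p = xs @ q @ ys" by (auto simp: sublist_def)
  from p have "(u, xs @ q @ ys) \<in> quiver_paths G" using xy pu by metis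
  moreover from this have "(path_target G (u, xs), q @ ys) \<in> quiver_paths G"
    by (rule quiver_paths_appendD)
  then have "path_target G (u, xs) = tail G (hd q)" using \<open>q \<noteq> []\<close>
    by (cases q) (auto simp: quiver_paths_Cons)
  ultimately show ?thesis
    using path_ideal_appendI[OF I, of "tail G (hd q)" q u xs ys] assms(2) pu xy
    by (metis path_elem_def)
qed

section \<open>Ideals generated by paths of length 2\<close>

lemma path_elem_long_paths:
  assumes "awalk u p v" "p \<noteq> []"
  shows "path_elem G p \<in> long_paths G (length p)"
  using assms by (cases p) (auto simp: path_elem_def long_paths_def quiver_paths_def awalk_Cons_iff)

lemma admissible_quadratic_ideal:
  assumes P: "P \<subseteq> {p. length p = 2 \<and> (\<exists>u v. awalk u p v)}"
    and m: "2 \<le> m" "\<And>p. \<lbrakk>p \<in> quiver_paths G; m \<le> length (snd p)\<rbrakk> \<Longrightarrow> \<exists>q\<in>P. sublist q (snd p)"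
  shows "admissible_ideal G (Idl\<^bsub>path_algebra G :: ('k::field, _) module\<^esub> (path_elem G ` P))"
    (is "admissible_ideal G ?I")
proof -
  interpret ring "path_algebra G :: ('k, _) module" by (rule ring_path_algebra)
  have sub: "path_elem G ` P \<subseteq> (long_paths G 2 :: (_ \<Rightarrow>\<^sub>0 'k) set)"
    using P path_elem_long_paths by fastforce
  then have carr: "path_elem G ` P \<subseteq> carrier (path_algebra G :: ('k, _) module)" by (auto simp: long_paths_def)
  note I = genideal_ideal[OF carr]
  have "long_paths G m \<subseteq> ?I"
  proof
    fix f :: "('a, 'b) quiver_path \<Rightarrow>\<^sub>0 'k" assume "f \<in> long_paths G m"
    then have "Poly_Mapping.keys f \<subseteq> {p \<in> quiver_paths G. m \<le> length (snd p)}" by (simp add: long_paths_def)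
    then show "f \<in> ?I"
    proof (rule path_ideal_spanI[OF I])
      fix p assume p: "p \<in> {p \<in> quiver_paths G. m \<le> length (snd p)}"
      then obtain q where q: "q \<in> P" "sublist q (snd p)" using m(2) by blast
      then have "path_elem G q \<in> ?I" "q \<noteq> []"
        using genideal_self[OF carr] P by auto
      then show "Poly_Mapping.single p 1 \<in> ?I"
        using single_sublist_in_ideal[OF I] q p by blast
    qed
  qed
  then show ?thesis
    unfolding admissible_ideal_iff using I genideal_minimal[OF ideal_long_paths sub] m(1) by blast
qed

text \<open>A product of arrows outside the ideal is nonzero, hence composable, and is not a
  generator. At-most-one conditions pass to smaller sets, so this one implication suffices.\<close>

lemma cond_S1_quadratic_ideal:
  assumes P: "P \<subseteq> {p. length p = 2 \<and> (\<exists>u v. awalk u p v)}"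
    and r: "\<And>a. a \<in> arcs G \<Longrightarrow> \<exists>\<^sub>\<le>\<^sub>1b. b \<in> arcs G \<and> head G a = tail G b \<and> [a, b] \<notin> P"
    and l: "\<And>a. a \<in> arcs G \<Longrightarrow> \<exists>\<^sub>\<le>\<^sub>1c. c \<in> arcs G \<and> head G c = tail G a \<and> [c, a] \<notin> P"
  shows "cond_S1 G (Idl\<^bsub>path_algebra G :: ('k::field, _) module\<^esub> (path_elem G ` P))"
    (is "cond_S1 G ?I")
proof -
  interpret ring "path_algebra G :: ('k, _) module" by (rule ring_path_algebra)
  have carr: "path_elem G ` P \<subseteq> carrier (path_algebra G :: ('k, _) module)"
    using P path_elem_long_paths by (fastforce simp: long_paths_def)
  note I = genideal_ideal[OF carr]
  have *: "head G a = tail G b \<and> [a, b] \<notin> P"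
    if "arrow_elem G a \<otimes>\<^bsub>path_algebra G\<^esub> arrow_elem G b \<notin> ?I" for a b
    using that genideal_self[OF carr] path_idealD(2)[OF I]
    by (auto simp: arrow_elem_mult split: if_splits)
  show ?thesis
    unfolding cond_S1_def
  proof (intro ballI conjI)
    fix a assume a: "a \<in> arcs G"
    show "\<exists>\<^sub>\<le>\<^sub>1b. b \<in> arcs G \<and> arrow_elem G a \<otimes>\<^bsub>path_algebra G\<^esub> arrow_elem G b \<notin> ?I"
      using r[OF a] * unfolding Uniq_def by blast
    show "\<exists>\<^sub>\<le>\<^sub>1c. c \<in> arcs G \<and> arrow_elem G c \<otimes>\<^bsub>path_algebra G\<^esub> arrow_elem G a \<notin> ?I"
      using l[OF a] * unfolding Uniq_def by blast
  qed
qed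

end

section \<open>Quiver morphisms deleting arrows\<close>

lemma (in ring_hom_ring) image_ideal:
  assumes surj: "h ` carrier R = carrier S" and I: "ideal I R"
  shows "ideal (h ` I) S"
proof (rule S.idealI_mult_closed)
  interpret I: ideal I R by fact
  show "h ` I \<subseteq> carrier S" using I.a_Hcarr by auto
  show "\<zero>\<^bsub>S\<^esub> \<in> h ` I" by (rule image_eqI[of _ _ \<zero>]) auto
  show "x \<oplus>\<^bsub>S\<^esub> y \<in> h ` I" if xy: "x \<in> h ` I" "y \<in> h ` I" for x y
  proof -
    from xy obtain i j where ij: "i \<in> I" "x = h i" "j \<in> I" "y = h j" by blast
    then have "x \<oplus>\<^bsub>S\<^esub> y = h (i \<oplus> j)" using I.a_Hcarr by simp
    then show ?thesis using I.a_closed[OF ij(1,3)] by blast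
  qed
  fix x s assume "x \<in> h ` I" and s: "s \<in> carrier S"
  then obtain i where i: "i \<in> I" "x = h i" by blast
  from s obtain r where r: "r \<in> carrier R" "s = h r" unfolding surj[symmetric] by blast
  have "s \<otimes>\<^bsub>S\<^esub> x = h (r \<otimes> i)" "x \<otimes>\<^bsub>S\<^esub> s = h (i \<otimes> r)" using i r I.a_Hcarr by simp_all
  then show "s \<otimes>\<^bsub>S\<^esub> x \<in> h ` I" "x \<otimes>\<^bsub>S\<^esub> s \<in> h ` I"
    using I.I_l_closed[OF i(1) r(1)] I.I_r_closed[OF i(1) r(1)] by blast+
qed

text \<open>One inclusion pulls an ideal back along \<open>h\<close>, the other pushes one forward;
  surjectivity makes the image of an ideal an ideal.\<close>

lemma (in ring_hom_ring) image_genideal: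
  assumes surj: "h ` carrier R = carrier S" and X: "X \<subseteq> carrier R"
  shows "h ` (Idl\<^bsub>R\<^esub> X) = Idl\<^bsub>S\<^esub> (h ` X)"
proof
  have hX: "h ` X \<subseteq> carrier S" using X by auto
  have "X \<subseteq> {r \<in> carrier R. h r \<in> Idl\<^bsub>S\<^esub> (h ` X)}"
    using X S.genideal_self[OF hX] by auto
  then have "Idl\<^bsub>R\<^esub> X \<subseteq> {r \<in> carrier R. h r \<in> Idl\<^bsub>S\<^esub> (h ` X)}"
    by (intro R.genideal_minimal ideal_vimage S.genideal_ideal hX)
  then show "h ` (Idl\<^bsub>R\<^esub> X) \<subseteq> Idl\<^bsub>S\<^esub> (h ` X)" by blast
  have "h ` X \<subseteq> h ` (Idl\<^bsub>R\<^esub> X)" using R.genideal_self[OF X] by blast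
  then show "Idl\<^bsub>S\<^esub> (h ` X) \<subseteq> h ` (Idl\<^bsub>R\<^esub> X)"
    by (intro S.genideal_minimal image_ideal surj R.genideal_ideal X)
qed

text \<open>Arrows in \<open>D\<close> are sent to \<open>0\<close>, whatever \<open>g\<close> does to them.\<close>

definition path_map ::
    "('v \<Rightarrow> 'w) \<Rightarrow> ('a \<Rightarrow> 'b) \<Rightarrow> 'a set \<Rightarrow> (('v, 'a) quiver_path \<Rightarrow>\<^sub>0 'k::field) \<Rightarrow> (('w, 'b) quiver_path \<Rightarrow>\<^sub>0 'k)"
  where "path_map f g D x = (\<Sum>p\<in>Poly_Mapping.keys x.
     if set (snd p) \<inter> D = {} then Poly_Mapping.single (f (fst p), map g (snd p)) (Poly_Mapping.lookup x p) else 0)"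

lemma path_map_superset:
  assumes "finite A" "Poly_Mapping.keys x \<subseteq> A"
  shows "path_map f g D x = (\<Sum>p\<in>A.
     if set (snd p) \<inter> D = {} then Poly_Mapping.single (f (fst p), map g (snd p)) (Poly_Mapping.lookup x p) else 0)"
  unfolding path_map_def using assms
  by (intro sum.mono_neutral_left) (auto simp: not_in_keys_iff_lookup_eq_zero)

lemma path_map_zero [simp]: "path_map f g D 0 = 0"
  by (simp add: path_map_def)

lemma path_map_single:
  "path_map f g D (Poly_Mapping.single p c) =
     (if set (snd p) \<inter> D = {} then Poly_Mapping.single (f (fst p), map g (snd p)) c else 0)"
  by (subst path_map_superset[of "{p}"]) auto

lemma path_map_add: "path_map f g D (x + y) = path_map f g D x + path_map f g D y"
proof -
  let ?A = "Poly_Mapping.keys x \<union> Poly_Mapping.keys y"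
  show ?thesis
    by (subst (1 2 3) path_map_superset[where A = ?A])
      (use keys_add[of x y] in \<open>auto simp: sum.distrib[symmetric] lookup_add single_add intro!: sum.cong\<close>)
qed

lemma path_map_diff: "path_map f g D (x - y) = path_map f g D x - path_map f g D y"
  using path_map_add[of f g D "x - y" y] by simp

lemma path_map_sum: "path_map f g D (\<Sum>i\<in>A. x i) = (\<Sum>i\<in>A. path_map f g D (x i))"
  by (induction A rule: infinite_finite_induct) (simp_all add: path_map_add)

lemma path_map_scale:
  "path_map f g D (Poly_Mapping.map ((*) c) x) = Poly_Mapping.map ((*) c) (path_map f g D x)"
  by (induction x rule: poly_mapping_linear_induct)
    (simp_all add: map_times_single path_map_single map_times_add path_map_add)

text \<open>One notion for two uses: identity maps with a set \<open>D\<close> describe the deletion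
  of arrows, and bijections with \<open>D = {}\<close> describe a renaming of the quiver.\<close>

locale quiver_cut = G: fin_digraph G + H: fin_digraph H
  for G :: "('v, 'a) pre_digraph" and H :: "('w, 'b) pre_digraph" +
  fixes f :: "'v \<Rightarrow> 'w" and g :: "'a \<Rightarrow> 'b" and D :: "'a set"
  assumes bij_verts: "bij_betw f (verts G) (verts H)"
    and bij_arcs: "bij_betw g (arcs G - D) (arcs H)"
    and D: "D \<subseteq> arcs G"
    and tail: "a \<in> arcs G - D \<Longrightarrow> tail H (g a) = f (tail G a)"
    and head: "a \<in> arcs G - D \<Longrightarrow> head H (g a) = f (head G a)"
begin

lemma target_map:
  assumes "p \<in> quiver_paths G" "set (snd p) \<inter> D = {}"
  shows "path_target H (f (fst p), map g (snd p)) = f (path_target G p)"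
proof -
  obtain u q where p: "p = (u, q)" by (cases p)
  have "last q \<in> arcs G - D" if "q \<noteq> []"
    using assms that G.quiver_paths_arcs[of u q] last_in_set[OF that] by (auto simp: p disjoint_iff)
  then show ?thesis by (auto simp: p path_target_simp last_map head)
qed

lemma map_in_quiver_paths:
  assumes "(u, p) \<in> quiver_paths G" "set p \<inter> D = {}"
  shows "(f u, map g p) \<in> quiver_paths H"
  using assms
proof (induction p arbitrary: u)
  case Nil
  then show ?case using bij_verts by (auto simp: bij_betw_def)
next
  case (Cons a p)
  then have "a \<in> arcs G - D" "u = tail G a" "(f (head G a), map g p) \<in> quiver_paths H"
    by (auto simp: G.quiver_paths_Cons)
  then show ?case
    using bij_arcs by (auto simp: H.quiver_paths_Cons tail head bij_betw_def)
qed

text \<open>Arrows lift one at a time through \<open>g\<close>; injectivity of \<open>f\<close> on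
  vertices makes consecutive lifts composable.\<close>

lemma quiver_path_lift:
  assumes "(f u, q) \<in> quiver_paths H" "u \<in> verts G"
  obtains p where "(u, p) \<in> quiver_paths G" "set p \<inter> D = {}" "q = map g p"
  using assms
proof (induction q arbitrary: u thesis)
  case Nil
  then show ?case by force
next
  case (Cons b q)
  then have b: "b \<in> arcs H" "f u = tail H b" "(head H b, q) \<in> quiver_paths H"
    by (auto simp: H.quiver_paths_Cons)
  from b(1) obtain a where a: "a \<in> arcs G - D" "b = g a" using bij_arcs by (auto simp: bij_betw_def)
  then have "f u = f (tail G a)" "tail G a \<in> verts G" "head G a \<in> verts G"
    using b tail[OF a(1)] G.wellformed by auto
  then have u: "u = tail G a" using bij_verts Cons.prems(3) by (auto simp: bij_betw_def inj_on_def)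
  from b(3) a head[OF a(1)] have "(f (head G a), q) \<in> quiver_paths H" by simp
  then obtain p where "(head G a, p) \<in> quiver_paths G" "set p \<inter> D = {}" "q = map g p"
    using Cons.IH[of "head G a"] \<open>head G a \<in> verts G\<close> by blast
  then show ?case using a u by (intro Cons.prems(1)[of "a # p"]) (auto simp: G.quiver_paths_Cons)
qed

abbreviation "\<pi> \<equiv> path_map f g D"

lemma path_map_closed:
  "Poly_Mapping.keys x \<subseteq> quiver_paths G \<Longrightarrow> Poly_Mapping.keys (\<pi> x) \<subseteq> quiver_paths H"
proof (induction x rule: poly_mapping_span_induct)
  case (single p c)
  then show ?case using map_in_quiver_paths[of "fst p" "snd p"] by (auto simp: path_map_single)
next
  case (add x y)
  then show ?case using keys_add[of "\<pi> x" "\<pi> y"] by (auto simp: path_map_add)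
qed simp

lemma path_map_mult:
  assumes "Poly_Mapping.keys x \<subseteq> quiver_paths G" "Poly_Mapping.keys y \<subseteq> quiver_paths G"
  shows "\<pi> (path_mult G x y) = path_mult H (\<pi> x) (\<pi> y)"
  using assms(1)
proof (induction x rule: poly_mapping_span_induct)
  case (single p c)
  show ?case using assms(2)
  proof (induction y rule: poly_mapping_span_induct)
    case (single q d)
    \<comment> \<open>Composable images must come from composable paths; this is injectivity of
      \<open>f\<close> on the vertices where they should meet.\<close>
    have "f (path_target G p) = f (fst q) \<longleftrightarrow> path_target G p = fst q"
      using bij_verts G.quiver_paths_verts[OF single] G.quiver_paths_verts[OF \<open>p \<in> quiver_paths G\<close>]
      by (auto simp: bij_betw_def inj_on_def)
    then show ?case
      using target_map[OF \<open>p \<in> quiver_paths G\<close>]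
      by (auto simp: path_mult_single path_map_single)
  qed (simp_all add: path_map_add path_mult_add_right)
qed (simp_all add: path_map_add path_mult_add_left)

lemma path_map_surj:
  assumes "Poly_Mapping.keys y \<subseteq> quiver_paths H"
  shows "\<exists>x. Poly_Mapping.keys x \<subseteq> quiver_paths G \<and> \<pi> x = y"
  using assms
proof (induction y rule: poly_mapping_span_induct)
  case (single q c)
  then have "fst q \<in> verts H" by (rule H.quiver_paths_verts)
  then obtain u where u: "u \<in> verts G" "fst q = f u" using bij_verts by (auto simp: bij_betw_def)
  then obtain p where p: "(u, p) \<in> quiver_paths G" "set p \<inter> D = {}" "snd q = map g p"
    using quiver_path_lift[of u "snd q"] single by (metis prod.collapse)
  then have "\<pi> (Poly_Mapping.single (u, p) c) = Poly_Mapping.single q c"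
    using u by (simp add: path_map_single) (metis prod.collapse)
  then show ?case using p(1) by (intro exI[of _ "Poly_Mapping.single (u, p) c"]) auto
next
  case (add y y')
  then obtain x x' where "Poly_Mapping.keys x \<subseteq> quiver_paths G" "\<pi> x = y"
    "Poly_Mapping.keys x' \<subseteq> quiver_paths G" "\<pi> x' = y'" by auto
  then show ?case using keys_add[of x x'] by (intro exI[of _ "x + x'"]) (auto simp: path_map_add)
qed (auto intro: exI[of _ 0])

lemma path_map_inj:
  assumes "p \<in> quiver_paths G" "set (snd p) \<inter> D = {}" "q \<in> quiver_paths G" "set (snd q) \<inter> D = {}"
    "f (fst p) = f (fst q)" "map g (snd p) = map g (snd q)"
  shows "p = q"
proof -
  have "fst p = fst q"
    using assms bij_verts G.quiver_paths_verts(1) by (auto simp: bij_betw_def inj_on_def)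
  moreover have "set (snd p) \<union> set (snd q) \<subseteq> arcs G - D"
    using assms G.quiver_paths_arcs[of "fst p" "snd p"] G.quiver_paths_arcs[of "fst q" "snd q"] by auto
  then have "inj_on g (set (snd p) \<union> set (snd q))"
    using bij_arcs by (auto simp: bij_betw_def intro: inj_on_subset)
  then have "snd p = snd q" using assms(6) by (metis map_inj_on)
  ultimately show ?thesis by (simp add: prod_eq_iff)
qed

lemma lookup_path_map:
  assumes "Poly_Mapping.keys x \<subseteq> quiver_paths G" and p: "p \<in> quiver_paths G" "set (snd p) \<inter> D = {}"
  shows "Poly_Mapping.lookup (\<pi> x) (f (fst p), map g (snd p)) = Poly_Mapping.lookup x p"
  using assms(1)
proof (induction x rule: poly_mapping_span_induct)
  case (single q c)
  then show ?case
    using path_map_inj[OF p, of q] p by (auto simp: path_map_single lookup_single when_def)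
qed (simp_all add: path_map_add lookup_add)

lemma path_map_ring_hom:
  "\<pi> \<in> ring_hom (path_algebra G :: ('k::field, _) module) (path_algebra H)"
proof (rule ring_hom_memI)
  show "\<pi> \<one>\<^bsub>path_algebra G\<^esub> = (\<one>\<^bsub>path_algebra H\<^esub> :: _ \<Rightarrow>\<^sub>0 'k)"
    using sum.reindex_bij_betw[OF bij_verts, of "\<lambda>w. Poly_Mapping.single (w, []) (1 :: 'k)"]
    by (simp add: path_map_sum path_map_single)
qed (simp_all add: path_map_closed path_map_mult path_map_add)

lemma path_map_image: "\<pi> ` carrier (path_algebra G) = carrier (path_algebra H)"
proof
  show "\<pi> ` carrier (path_algebra G) \<subseteq> carrier (path_algebra H)" using path_map_closed by auto
  show "carrier (path_algebra H) \<subseteq> \<pi> ` carrier (path_algebra G)" using path_map_surj by force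
qed

lemma path_map_ring_hom_ring: "ring_hom_ring (path_algebra G) (path_algebra H) \<pi>"
  by (rule ring_hom_ringI2[OF G.ring_path_algebra H.ring_path_algebra path_map_ring_hom])

text \<open>A path avoiding \<open>D\<close> would keep its coefficient under \<open>\<pi>\<close>.
  The support of \<open>x\<close> thus consists of paths through an arrow of \<open>D\<close>, and
  these lie in \<open>I\<close>.\<close>

lemma path_map_kernel:
  assumes I: "ideal I (path_algebra G)" and DI: "arrow_elem G ` D \<subseteq> I"
    and x: "Poly_Mapping.keys x \<subseteq> quiver_paths G" "\<pi> x = 0"
  shows "x \<in> I"
proof (rule G.path_ideal_spanI[OF I subset_refl])
  fix p assume p: "p \<in> Poly_Mapping.keys x"
  then have "set (snd p) \<inter> D \<noteq> {}"
    using lookup_path_map[OF x(1), of p] x by (auto simp: in_keys_iff)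
  then obtain a where a: "a \<in> D" "a \<in> set (snd p)" by auto
  then have "sublist [a] (snd p)"
    using split_list[of a "snd p"] by (auto simp: sublist_def)
  then show "Poly_Mapping.single p 1 \<in> I"
    using DI a p x(1) by (intro G.single_sublist_in_ideal[OF I, of "[a]"]) (auto simp: arrow_elem_def)
qed

lemma quotient_path_algebra_iso:
  assumes I: "ideal I (path_algebra G)" and DI: "arrow_elem G ` D \<subseteq> I"
  shows "algebra_iso (quotient_algebra (path_algebra G) I) (quotient_algebra (path_algebra H) (\<pi> ` I))"
proof (rule k_algebra.quotient_algebra_iso[OF G.k_algebra_path_algebra H.k_algebra_path_algebra path_map_ring_hom path_map_image])
  show "ideal (\<pi> ` I) (path_algebra H)"
    by (rule ring_hom_ring.image_ideal[OF path_map_ring_hom_ring path_map_image I])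
  \<comment> \<open>Elements with the same image differ by an element of the kernel, which is
    contained in \<open>I\<close>.\<close>
  show "I = {x \<in> carrier (path_algebra G). \<pi> x \<in> \<pi> ` I}"
  proof (intro equalityI subsetI CollectI conjI)
    fix x assume "x \<in> {x \<in> carrier (path_algebra G). \<pi> x \<in> \<pi> ` I}"
    then obtain i where i: "Poly_Mapping.keys x \<subseteq> quiver_paths G" "i \<in> I" "\<pi> x = \<pi> i" by auto
    have "Poly_Mapping.keys (x - i) \<subseteq> quiver_paths G"
      using i(1) G.path_idealD(1)[OF I] i(2) keys_diff[of x i] by auto
    then have "x - i \<in> I"
      by (rule path_map_kernel[OF I DI]) (simp add: path_map_diff i)
    then have "(x - i) + i \<in> I" using i(2) G.path_idealD(3)[OF I] by blast
    then show "x \<in> I" by simp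
  qed (use G.path_idealD(1)[OF I] in auto)
qed (simp add: path_map_scale)

end

section \<open>Connected quivers and indecomposable algebras\<close>

text \<open>Stated through vertex sets closed under arrows in both directions, since such sets
  correspond to decompositions of the algebra. The empty quiver qualifies, so
  \<open>verts G \<noteq> {}\<close> appears as a separate condition.\<close>

definition quiver_connected :: "('v, 'a) pre_digraph \<Rightarrow> bool" where
  "quiver_connected Q \<longleftrightarrow>
     (\<forall>W\<subseteq>verts Q. (\<forall>a\<in>arcs Q. tail Q a \<in> W \<longleftrightarrow> head Q a \<in> W) \<longrightarrow> W = {} \<or> W = verts Q)"

text \<open>For reasons of length, \<open>r\<close> arises in the product only from trivial paths of
  \<open>x\<close> and \<open>y\<close>. Taking for \<open>r\<close> a vertex or an arrow yields the
  equations for the vertex coefficients of an idempotent.\<close>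

lemma lookup_path_mult_middle:
  "Poly_Mapping.lookup (path_mult Q (path_mult Q x (Poly_Mapping.single r 1)) y) r =
     Poly_Mapping.lookup x (fst r, []) * Poly_Mapping.lookup y (path_target Q r, [])"
proof (induction x rule: poly_mapping_linear_induct)
  case (single p c)
  show ?case
  proof (induction y rule: poly_mapping_linear_induct)
    case (single q d)
    obtain u xs v ys w zs where [simp]: "p = (u, xs)" "q = (v, ys)" "r = (w, zs)"
      by (cases p; cases q; cases r)
    have "xs @ zs @ ys = zs \<longleftrightarrow> xs = [] \<and> ys = []" by (auto dest: arg_cong[of _ _ length])
    then show ?case
      by (auto simp: path_mult_single lookup_single when_def path_target_append path_target_simp)
  qed (simp_all add: path_mult_add_right lookup_add distrib_left)
qed (simp_all add: path_mult_add_left lookup_add distrib_right)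

lemma ideal_zero_closed: "ideal I R \<Longrightarrow> \<zero>\<^bsub>R\<^esub> \<in> I"
  by (rule additive_subgroup.zero_closed[OF ideal.axioms(1)])

context k_algebra
begin

lemma coset_eq_zero_iff:
  assumes "ideal I A" "x \<in> carrier A"
  shows "I +> x = \<zero>\<^bsub>quotient_algebra A I\<^esub> \<longleftrightarrow> x \<in> I"
proof -
  interpret I: ideal I A by fact
  show ?thesis
    unfolding quotient_algebra_zero using I.a_rcos_const[of x] I.a_rcos_self[OF assms(2)] by blast
qed

lemma coset_eqD:
  assumes "ideal I A" "x \<in> carrier A" "y \<in> carrier A" "I +> x = I +> y"
  shows "x \<ominus> y \<in> I"
  using quotient_eq_iff_same_a_r_cos[OF assms(1-3)] assms(4) by simp

end

context fin_digraph
begin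

lemma closed_vertex_set_path:
  assumes W: "\<And>a. a \<in> arcs G \<Longrightarrow> tail G a \<in> W \<longleftrightarrow> head G a \<in> W" and "(u, p) \<in> quiver_paths G"
  shows "u \<in> W \<longleftrightarrow> path_target G (u, p) \<in> W"
  using assms(2)
proof (induction p arbitrary: u)
  case (Cons a p)
  then have "a \<in> arcs G" "u = tail G a" "head G a \<in> W \<longleftrightarrow> path_target G (head G a, p) \<in> W"
    by (auto simp: quiver_paths_Cons)
  moreover have "path_target G (u, a # p) = path_target G (head G a, p)" by (simp add: path_target_simp)
  ultimately show ?case using W[of a] by metis
qed (simp add: path_target_simp)

lemma trivial_path_notin:
  "I \<subseteq> long_paths G 2 \<Longrightarrow> Poly_Mapping.single (v, []) (1::'k::field) \<notin> I"
  by (auto simp: long_paths_def)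

text \<open>The paths starting in a closed vertex set and those starting in its complement span two
  complementary ideals. Elements of \<open>I\<close> involve only paths of length at least 2, so no
  vertex vanishes in the quotient and one of the two sets must be empty.\<close>

lemma indecomposable_imp_connected:
  fixes I :: "(_ \<Rightarrow>\<^sub>0 'k::field) set"
  assumes I: "ideal I (path_algebra G)" "I \<subseteq> long_paths G 2"
    and indec: "indecomposable_algebra (quotient_algebra (path_algebra G) I)"
  shows "quiver_connected G" "verts G \<noteq> {}"
proof -
  let ?A = "path_algebra G :: ('k, _) module" and ?B = "quotient_algebra (path_algebra G) I"
  let ?q = "\<lambda>x. I +>\<^bsub>?A\<^esub> x"
  interpret A: k_algebra ?A by (rule k_algebra_path_algebra)
  interpret q: ring_hom_ring ?A ?B ?q by (rule A.coset_ring_hom[OF I(1)])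
  show "verts G \<noteq> {}"
  proof
    assume "verts G = {}"
    then have "quiver_paths G = {}" using quiver_paths_verts(1) by auto
    then have "carrier ?A = {0}" by simp
    then have "carrier ?B = {?q 0}" unfolding A.carrier_quotient_algebra by simp
    then show False
      using indec A.coset_eq_zero_iff[OF I(1), of 0] path_idealD(2)[OF I(1)]
      unfolding indecomposable_algebra_def by simp
  qed
  show "quiver_connected G"
    unfolding quiver_connected_def
  proof (intro allI impI)
    fix W assume W: "W \<subseteq> verts G" "\<forall>a\<in>arcs G. tail G a \<in> W \<longleftrightarrow> head G a \<in> W"
    define X where "X U = {x :: _ \<Rightarrow>\<^sub>0 'k. Poly_Mapping.keys x \<subseteq> {p \<in> quiver_paths G. fst p \<in> U}}" for U
    define e where "e U = (\<Sum>v\<in>U. Poly_Mapping.single (v, [] :: 'b list) (1::'k))" for U :: "'a set"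
    define U where "U = verts G - W"
    have closed: "\<And>a. a \<in> arcs G \<Longrightarrow> tail G a \<in> W \<longleftrightarrow> head G a \<in> W"
      "\<And>a. a \<in> arcs G \<Longrightarrow> tail G a \<in> U \<longleftrightarrow> head G a \<in> U"
      using W wellformed by (auto simp: U_def)
    have fin: "finite W" "finite U" using W(1) finite_subset[OF _ finite_verts] by (auto simp: U_def)
    have X_carr: "X V \<subseteq> carrier ?A" for V by (auto simp: X_def)
    \<comment> \<open>The span absorbs left multiplication because a path that ends in the closed
      set \<open>V\<close> also starts there.\<close>
    have idX: "ideal (X V) ?A" if V: "\<And>a. a \<in> arcs G \<Longrightarrow> tail G a \<in> V \<longleftrightarrow> head G a \<in> V" for V
    proof (rule A.idealI_mult_closed)
      show "x \<oplus>\<^bsub>?A\<^esub> y \<in> X V" if "x \<in> X V" "y \<in> X V" for x y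
        using that keys_add[of x y] by (auto simp: X_def)
      fix x r assume x: "x \<in> X V" and r: "r \<in> carrier ?A"
      have *: "fst s \<in> V" if "s \<in> Poly_Mapping.keys (path_mult G r x)" for s
      proof -
        from subsetD[OF keys_path_mult that] obtain p p' where
          s: "s = (fst p, snd p @ snd p')" "p \<in> Poly_Mapping.keys r" "p' \<in> Poly_Mapping.keys x"
            "path_target G p = fst p'" by blast
        then have "fst p' \<in> V" "p \<in> quiver_paths G" using x r by (auto simp: X_def)
        then show ?thesis using s closed_vertex_set_path[OF V, of "fst p" "snd p"] by simp
      qed
      have **: "fst s \<in> V" if "s \<in> Poly_Mapping.keys (path_mult G x r)" for s
        using subsetD[OF keys_path_mult that] x by (auto simp: X_def)
      have "Poly_Mapping.keys x \<subseteq> quiver_paths G" "Poly_Mapping.keys r \<subseteq> quiver_paths G"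
        using x r by (auto simp: X_def)
      then have "Poly_Mapping.keys (path_mult G r x) \<subseteq> quiver_paths G" "Poly_Mapping.keys (path_mult G x r) \<subseteq> quiver_paths G"
        by (auto dest: path_mult_closed)
      then show "r \<otimes>\<^bsub>?A\<^esub> x \<in> X V" "x \<otimes>\<^bsub>?A\<^esub> r \<in> X V"
        using * ** by (auto simp: X_def)
    qed (auto simp: X_def)
    have idq: "ideal (?q ` X W) ?B" "ideal (?q ` X U) ?B"
      by (intro q.image_ideal A.carrier_quotient_algebra[symmetric] idX closed; assumption)+
    have "?q ` X W \<inter> ?q ` X U \<subseteq> {\<zero>\<^bsub>?B\<^esub>}"
    proof
      fix z assume "z \<in> ?q ` X W \<inter> ?q ` X U"
      then obtain x y where xy: "x \<in> X W" "z = ?q x" "y \<in> X U" "z = ?q y" by auto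
      note carr = subsetD[OF X_carr xy(1)] subsetD[OF X_carr xy(3)]
      have "?q x = ?q y" using xy(2,4) by (rule subst)
      then have "x \<ominus>\<^bsub>?A\<^esub> y \<in> I" by (rule A.coset_eqD[OF I(1) carr])
      then have xyI: "x - y \<in> I" unfolding path_algebra_minus[OF carr] .
      \<comment> \<open>The idempotent of \<open>W\<close> keeps \<open>x\<close> and kills
        \<open>y\<close>. As \<open>x - y\<close> lies in \<open>I\<close>, so does
        \<open>x\<close>.\<close>
      have "Poly_Mapping.lookup (path_mult G (e W) (x - y)) p = Poly_Mapping.lookup x p" for p
        using fin xy by (auto simp: e_def lookup_path_mult_vertices lookup_minus X_def U_def in_keys_iff)
      then have "path_mult G (e W) (x - y) = x" by (intro poly_mapping_eqI)
      moreover have "Poly_Mapping.keys (e W) \<subseteq> quiver_paths G"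
        unfolding e_def by (rule order_trans[OF keys_sum]) (use W(1) in auto)
      then have "path_mult G (e W) (x - y) \<in> I" by (rule path_idealD(6)[OF I(1) xyI])
      ultimately have "x \<in> I" by (simp only:)
      then have "?q x = \<zero>\<^bsub>?B\<^esub>" unfolding A.coset_eq_zero_iff[OF I(1) carr(1)] .
      then show "z \<in> {\<zero>\<^bsub>?B\<^esub>}" unfolding xy(2) singleton_iff .
    qed
    then have int: "?q ` X W \<inter> ?q ` X U = {\<zero>\<^bsub>?B\<^esub>}"
      by (intro equalityI insert_subsetI empty_subsetI IntI ideal_zero_closed idq)
    have "carrier ?B \<subseteq> ?q ` X W <+>\<^bsub>?B\<^esub> ?q ` X U"
    proof
      fix b assume "b \<in> carrier ?B"
      then obtain z where z: "z \<in> carrier ?A" "b = ?q z" unfolding A.carrier_quotient_algebra by blast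
      \<comment> \<open>The idempotents of \<open>W\<close> and \<open>U\<close> add up to the unit
        and split \<open>z\<close>.\<close>
      let ?x = "path_mult G (e W) z" and ?y = "path_mult G (e U) z"
      have x: "?x \<in> X W" and y: "?y \<in> X U"
        using z(1) fin unfolding X_def e_def by (auto simp: in_keys_iff lookup_path_mult_vertices split: if_splits)
      have "?x + ?y = z"
        using z(1) fin quiver_paths_verts(1)
        by (intro poly_mapping_eqI) (auto simp: lookup_add e_def lookup_path_mult_vertices in_keys_iff U_def)
      then have "b = ?q ?x \<oplus>\<^bsub>?B\<^esub> ?q ?y"
        using q.hom_add[OF subsetD[OF X_carr x] subsetD[OF X_carr y]] z(2)
        by (simp only: path_algebra_simps(5))
      then show "b \<in> ?q ` X W <+>\<^bsub>?B\<^esub> ?q ` X U" using x y unfolding set_add_def' by blast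
    qed
    moreover have "?q ` X W <+>\<^bsub>?B\<^esub> ?q ` X U \<subseteq> carrier ?B"
      using idq q.S.add_additive_subgroups ideal.axioms(1) additive_subgroup.a_subset by blast
    ultimately have "?q ` X W = {\<zero>\<^bsub>?B\<^esub>} \<or> ?q ` X U = {\<zero>\<^bsub>?B\<^esub>}"
      using indec idq int unfolding indecomposable_algebra_def by blast
    moreover have "V = {}" if V: "?q ` X V = {\<zero>\<^bsub>?B\<^esub>}" "V \<subseteq> verts G" for V
    proof (rule ccontr)
      assume "V \<noteq> {}"
      then obtain v where v: "v \<in> V" by blast
      then have "Poly_Mapping.single (v, []) 1 \<in> X V" using V(2) by (auto simp: X_def)
      moreover from this have "Poly_Mapping.single (v, []) 1 \<in> carrier ?A" using X_carr by blast
      ultimately have "Poly_Mapping.single (v, []) 1 \<in> I"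
        using V(1) A.coset_eq_zero_iff[OF I(1)] by blast
      then show False using trivial_path_notin[OF I(2)] by blast
    qed
    ultimately show "W = {} \<or> W = verts G" using W(1) unfolding U_def by blast
  qed
qed

text \<open>Modulo \<open>I\<close>, \<open>x\<close> equals its square and hence \<open>x y\<close>
  for every \<open>y\<close> congruent to \<open>x\<close>. Each round raises the minimal length of
  the paths by one until they all lie in \<open>I\<close>.\<close>

lemma idempotent_radical_in_ideal:
  fixes x :: "_ \<Rightarrow>\<^sub>0 'k::field"
  assumes I: "ideal I (path_algebra G)" "long_paths G m \<subseteq> I"
    and x: "x \<in> long_paths G 1" "x - path_mult G x x \<in> I"
  shows "x \<in> I"
proof -
  have xp: "Poly_Mapping.keys x \<subseteq> quiver_paths G" using x(1) by (auto simp: long_paths_def)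
  have "\<exists>y\<in>long_paths G (Suc k). x - y \<in> I" for k
  proof (induction k)
    case 0
    then show ?case using x path_idealD(2)[OF I(1)] by (intro bexI[of _ x]) auto
  next
    case (Suc k)
    then obtain y where y: "y \<in> long_paths G (Suc k)" "x - y \<in> I" by blast
    have "path_mult G x (x - y) \<in> I" by (rule path_idealD(6)[OF I(1) y(2) xp])
    then have "(x - path_mult G x x) + path_mult G x (x - y) \<in> I" using x(2) path_idealD(3)[OF I(1)] by blast
    moreover have "path_mult G x x = path_mult G x (x - y) + path_mult G x y"
      by (simp flip: path_mult_add_right)
    ultimately have "x - path_mult G x y \<in> I" by simp
    moreover have "path_mult G x y \<in> long_paths G (Suc (Suc k))"
      using path_mult_long_paths[OF x(1) y(1)] by simp
    ultimately show ?case by blast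
  qed
  then obtain y where y: "y \<in> long_paths G (Suc m)" "x - y \<in> I" by blast
  then have "y \<in> I" using I(2) long_paths_antimono[of m "Suc m" G] by auto
  then have "(x - y) + y \<in> I" using y(2) path_idealD(3)[OF I(1)] by blast
  then show ?thesis by simp
qed

lemma long_paths_1I:
  assumes x: "Poly_Mapping.keys x \<subseteq> quiver_paths G"
    and c: "\<And>v. v \<in> verts G \<Longrightarrow> Poly_Mapping.lookup x (v, []) = 0"
  shows "x \<in> long_paths G 1"
proof -
  have "1 \<le> length (snd p)" if p: "p \<in> Poly_Mapping.keys x" for p
  proof (rule ccontr)
    assume "\<not> 1 \<le> length (snd p)"
    then have pe: "p = (fst p, [])" by (cases p) (auto simp: not_le)
    then have "fst p \<in> verts G" using x p quiver_paths_verts(1)[of p] by auto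
    then show False using c[of "fst p"] pe p by (metis in_keys_iff)
  qed
  then show ?thesis using x by (auto simp: long_paths_def)
qed

lemma lookup_one_path_algebra:
  "v \<in> verts G \<Longrightarrow> Poly_Mapping.lookup (\<Sum>v\<in>verts G. Poly_Mapping.single (v, []) 1) (v, []) = (1::'k::field)"
  by (simp add: lookup_sum lookup_single when_def sum.delta)

lemma connected_imp_indecomposable:
  fixes I :: "(_ \<Rightarrow>\<^sub>0 'k::field) set"
  assumes adm: "admissible_ideal G I" and conn: "quiver_connected G" and ne: "verts G \<noteq> {}"
  shows "indecomposable_algebra (quotient_algebra (path_algebra G) I)"
proof -
  from adm obtain m where I: "ideal I (path_algebra G)" "I \<subseteq> long_paths G 2" "long_paths G m \<subseteq> I"
    by (auto simp: admissible_ideal_iff)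
  let ?A = "path_algebra G :: ('k, _) module" and ?B = "quotient_algebra (path_algebra G) I"
  let ?q = "\<lambda>x. I +>\<^bsub>?A\<^esub> x"
  interpret A: k_algebra ?A by (rule k_algebra_path_algebra)
  interpret q: ring_hom_ring ?A ?B ?q by (rule A.coset_ring_hom[OF I(1)])
  note zero_iff = A.coset_eq_zero_iff[OF I(1)]
  define one where "one = \<one>\<^bsub>?A\<^esub>"
  have one: "one \<in> carrier ?A" unfolding one_def by (rule A.one_closed)
  have minus: "one - x \<in> carrier ?A" if "x \<in> carrier ?A" for x
    using path_algebra_minus[OF one that] one that by (metis A.minus_closed)
  have qone: "?q one = \<one>\<^bsub>?B\<^esub>" unfolding one_def by (rule q.hom_one)
  \<comment> \<open>The product lies in both ideals and so vanishes modulo \<open>I\<close>. The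
    free middle factor takes the place of centrality; it will be the unit, a vertex or an
    arrow.\<close>
  have prod_zero: "path_mult G (path_mult G x z) y \<in> I"
    if "ideal K ?B" "ideal L ?B" "K \<inter> L = {\<zero>\<^bsub>?B\<^esub>}" "x \<in> carrier ?A" "?q x \<in> K" "y \<in> carrier ?A" "?q y \<in> L"
      "z \<in> carrier ?A" for K L x y z
  proof -
    have c: "x \<otimes>\<^bsub>?A\<^esub> z \<in> carrier ?A" "(x \<otimes>\<^bsub>?A\<^esub> z) \<otimes>\<^bsub>?A\<^esub> y \<in> carrier ?A"
      using A.m_closed[OF that(4,8)] A.m_closed[OF A.m_closed[OF that(4,8)] that(6)] .
    note K = that(1) and L = that(2)
    have "?q ((x \<otimes>\<^bsub>?A\<^esub> z) \<otimes>\<^bsub>?A\<^esub> y) = (?q x \<otimes>\<^bsub>?B\<^esub> ?q z) \<otimes>\<^bsub>?B\<^esub> ?q y"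
      unfolding q.hom_mult[OF c(1) that(6)] q.hom_mult[OF that(4,8)] ..
    moreover have "?q x \<otimes>\<^bsub>?B\<^esub> ?q z \<in> K" "?q x \<otimes>\<^bsub>?B\<^esub> ?q z \<in> carrier ?B"
      using ideal.I_r_closed[OF K that(5) q.hom_closed[OF that(8)]]
        q.S.m_closed[OF q.hom_closed[OF that(4)] q.hom_closed[OF that(8)]] .
    ultimately have "?q ((x \<otimes>\<^bsub>?A\<^esub> z) \<otimes>\<^bsub>?A\<^esub> y) \<in> K \<inter> L"
      using ideal.I_r_closed[OF K _ q.hom_closed[OF that(6)]] ideal.I_l_closed[OF L that(7)] by (metis IntI)
    then have "(x \<otimes>\<^bsub>?A\<^esub> z) \<otimes>\<^bsub>?A\<^esub> y \<in> I"
      unfolding that(3) zero_iff[OF c(2), symmetric] by (rule singletonD)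
    then show ?thesis unfolding path_algebra_simps(2) .
  qed
  \<comment> \<open>Without vertex coefficients \<open>x\<close> lies in the arrow ideal, and its
    product with \<open>one - x\<close> shows that it is idempotent modulo \<open>I\<close>. So
    \<open>x\<close> vanishes, \<open>L\<close> contains the unit, and \<open>K\<close> equals
    \<open>K \<inter> L\<close>.\<close>
  have trivial: "K = {\<zero>\<^bsub>?B\<^esub>}"
    if K: "ideal K ?B" and L: "ideal L ?B" and KL: "K \<inter> L = {\<zero>\<^bsub>?B\<^esub>}"
      and x: "x \<in> carrier ?A" "?q x \<in> K" "?q (one - x) \<in> L"
      and c: "\<And>v. v \<in> verts G \<Longrightarrow> Poly_Mapping.lookup x (v, []) = 0" for K L x
  proof -
    have "path_mult G (path_mult G x one) (one - x) \<in> I"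
      using prod_zero[OF K L KL x(1,2) minus[OF x(1)] x(3) one] .
    moreover have "path_mult G x one = x"
      using A.r_one[OF x(1)] unfolding one_def path_algebra_simps(2) .
    moreover have "path_mult G x one = path_mult G x (one - x) + path_mult G x x"
      by (simp flip: path_mult_add_right)
    ultimately have "x - path_mult G x x \<in> I" by (metis add_diff_cancel_right')
    moreover have "x \<in> long_paths G 1" using x(1) c by (intro long_paths_1I) auto
    ultimately have "x \<in> I" using idempotent_radical_in_ideal[OF I(1,3)] by blast
    then have qx: "?q x = \<zero>\<^bsub>?B\<^esub>" using zero_iff[OF x(1)] by blast
    have "?q (x \<oplus>\<^bsub>?A\<^esub> (one - x)) = ?q x \<oplus>\<^bsub>?B\<^esub> ?q (one - x)"
      by (rule q.hom_add[OF x(1) minus[OF x(1)]])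
    then have "\<one>\<^bsub>?B\<^esub> = ?q (one - x)"
      unfolding path_algebra_simps(5) qx q.S.l_zero[OF q.hom_closed[OF minus[OF x(1)]]]
      by (simp only: add_diff_cancel_left' diff_add_cancel add.commute[of x] qone)
    then have "\<one>\<^bsub>?B\<^esub> \<in> L" using x(3) by (simp only:)
    then have "L = carrier ?B" by (rule ideal.one_imp_carrier[OF L])
    then have "K \<subseteq> L" using additive_subgroup.a_subset[OF ideal.axioms(1)[OF K]] by (simp only:)
    then show ?thesis unfolding KL[symmetric] by (rule Int_absorb2[symmetric])
  qed
  show ?thesis
    unfolding indecomposable_algebra_def
  proof (intro conjI allI impI)
    from ne obtain v where v: "v \<in> verts G" by blast
    then have vc: "Poly_Mapping.single (v, []) 1 \<in> carrier ?A" by simp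
    have "?q (Poly_Mapping.single (v, []) 1) \<noteq> \<zero>\<^bsub>?B\<^esub>"
      unfolding zero_iff[OF vc] by (rule trivial_path_notin[OF I(2)])
    then show "carrier ?B \<noteq> {\<zero>\<^bsub>?B\<^esub>}" using q.hom_closed[OF vc] by (metis singletonD)
  next
    fix K L assume "ideal K ?B \<and> ideal L ?B \<and> K \<inter> L = {\<zero>\<^bsub>?B\<^esub>} \<and> K <+>\<^bsub>?B\<^esub> L = carrier ?B"
    then have K: "ideal K ?B" and L: "ideal L ?B" and KL: "K \<inter> L = {\<zero>\<^bsub>?B\<^esub>}" and sum: "K <+>\<^bsub>?B\<^esub> L = carrier ?B"
      by auto
    have "\<one>\<^bsub>?B\<^esub> \<in> K <+>\<^bsub>?B\<^esub> L" unfolding sum by (rule q.S.one_closed)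
    then obtain k l where kl: "k \<in> K" "l \<in> L" "\<one>\<^bsub>?B\<^esub> = k \<oplus>\<^bsub>?B\<^esub> l" unfolding set_add_def' by blast
    have "k \<in> (+>\<^bsub>?A\<^esub>) I ` carrier ?A" using additive_subgroup.a_Hcarr[OF ideal.axioms(1)[OF K] kl(1)] unfolding A.carrier_quotient_algebra .
    then obtain x where x: "x \<in> carrier ?A" "k = ?q x" by blast
    \<comment> \<open>Lifting only \<open>k\<close> and taking the complement makes the two lifts
      add up to \<open>one\<close> exactly; \<open>l\<close> is then the class of
      \<open>?y\<close>.\<close>
    let ?y = "one - x"
    note y = minus[OF x(1)]
    have "?q (x \<oplus>\<^bsub>?A\<^esub> ?y) = ?q x \<oplus>\<^bsub>?B\<^esub> ?q ?y" by (rule q.hom_add[OF x(1) y])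
    then have "?q one = k \<oplus>\<^bsub>?B\<^esub> ?q ?y"
      unfolding path_algebra_simps(5) x(2) by (simp only: diff_add_cancel add.commute[of x])
    then have eq: "k \<oplus>\<^bsub>?B\<^esub> l = k \<oplus>\<^bsub>?B\<^esub> ?q ?y" unfolding kl(3)[symmetric] qone .
    note carr = additive_subgroup.a_Hcarr[OF ideal.axioms(1)[OF K] kl(1)]
      additive_subgroup.a_Hcarr[OF ideal.axioms(1)[OF L] kl(2)]
    have "l = \<ominus>\<^bsub>?B\<^esub> k \<oplus>\<^bsub>?B\<^esub> (k \<oplus>\<^bsub>?B\<^esub> l)" by (rule q.S.r_neg1[OF carr, symmetric])
    also have "\<dots> = ?q ?y" unfolding eq by (rule q.S.r_neg1[OF carr(1) q.hom_closed[OF y]])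
    finally have ly: "l = ?q ?y" .
    have qK: "?q x \<in> K" using kl(1) unfolding x(2) .
    have qL: "?q ?y \<in> L" using kl(2) unfolding ly .
    have LK: "L \<inter> K = {\<zero>\<^bsub>?B\<^esub>}" using KL by blast
    \<comment> \<open>\<open>x\<close> and \<open>1 - x\<close> lift the central idempotents that generate \<open>K\<close> and \<open>L\<close>.\<close>
    have xy: "path_mult G (path_mult G x z) ?y \<in> I" "path_mult G (path_mult G ?y z) x \<in> I"
      if "z \<in> carrier ?A" for z
      using prod_zero[OF K L KL x(1) qK y qL that] prod_zero[OF L K LK y qL x(1) qK that] .
    define c where "c v = Poly_Mapping.lookup x (v, [])" for v
    have cy: "Poly_Mapping.lookup ?y (v, []) = 1 - c v" if "v \<in> verts G" for v
      using lookup_one_path_algebra[OF that, where 'k = 'k] by (simp add: one_def c_def lookup_minus)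
    have low: "Poly_Mapping.lookup z p = 0" if "z \<in> I" "length (snd p) < 2" for z p
      using I(2) that by (fastforce simp: long_paths_def in_keys_iff)
    \<comment> \<open>The coefficient of \<open>p\<close> in the products of \<open>xy\<close> with
      middle factor \<open>p\<close>: they lie in \<open>I\<close>, which contains no terms of
      length below 2.\<close>
    have cc: "c (fst p) * (1 - c (path_target G p)) = 0" "(1 - c (fst p)) * c (path_target G p) = 0"
      if p: "p \<in> quiver_paths G" "length (snd p) < 2" for p
    proof -
      have z: "Poly_Mapping.single p 1 \<in> carrier ?A" using p(1) by simp
      show "c (fst p) * (1 - c (path_target G p)) = 0" "(1 - c (fst p)) * c (path_target G p) = 0"
        using low[OF xy(1)[OF z] p(2)] low[OF xy(2)[OF z] p(2)]
          cy[OF quiver_paths_verts(1)[OF p(1)]] cy[OF quiver_paths_verts(2)[OF p(1)]]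
        unfolding lookup_path_mult_middle by (simp_all add: c_def)
    qed
    have c01: "c v = 0 \<or> c v = 1" if "v \<in> verts G" for v
      using cc(1)[of "(v, [])"] that by (simp add: path_target_simp)
    define W where "W = {v \<in> verts G. c v = 1}"
    have W_iff: "tail G a \<in> W \<longleftrightarrow> head G a \<in> W" if a: "a \<in> arcs G" for a
    proof -
      have "(tail G a, [a]) \<in> quiver_paths G" using a wellformed by (simp add: quiver_paths_Cons)
      from cc[OF this] show ?thesis using a wellformed by (auto simp: W_def path_target_simp)
    qed
    have "W \<subseteq> verts G" unfolding W_def by (rule Collect_subset)
    then have "W = {} \<or> W = verts G"
      using W_iff by (rule conn[unfolded quiver_connected_def, rule_format])
    then show "K = {\<zero>\<^bsub>?B\<^esub>} \<or> L = {\<zero>\<^bsub>?B\<^esub>}"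
    proof (rule disjE)
      assume "W = {}"
      have "Poly_Mapping.lookup x (v, []) = 0" if v: "v \<in> verts G" for v
      proof -
        have "v \<notin> W" unfolding \<open>W = {}\<close> by (rule emptyE[THEN notI])
        then have "c v \<noteq> 1" unfolding W_def mem_Collect_eq using v by fast
        with c01[OF v] show ?thesis unfolding c_def by fast
      qed
      then have "K = {\<zero>\<^bsub>?B\<^esub>}" by (rule trivial[OF K L KL x(1) qK qL])
      then show ?thesis ..
    next
      assume "W = verts G"
      have "Poly_Mapping.lookup ?y (v, []) = 0" if v: "v \<in> verts G" for v
      proof -
        have "v \<in> W" unfolding \<open>W = verts G\<close> by (rule v)
        then have "c v = 1" unfolding W_def mem_Collect_eq by (rule conjunct2)
        then show ?thesis unfolding cy[OF v] by (simp only: diff_self)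
      qed
      moreover have "one - ?y = x" by (simp only: diff_diff_eq2 add_diff_cancel_left')
      then have "?q (one - ?y) \<in> K" using qK by (simp only:)
      ultimately have "L = {\<zero>\<^bsub>?B\<^esub>}" by (intro trivial[OF L K LK y qL])
      then show ?thesis ..
    qed
  qed
qed

end

section \<open>Quotients by quadratic monomial relations\<close>

context fin_digraph
begin

text \<open>Presentations in \<open>almost_gentle\<close> live on natural numbers. The maps go from
  numbers to vertices and arrows, so the renaming is a cut with nothing deleted.\<close>

lemma quiver_relabel_nat:
  obtains Q' :: "(nat, nat) pre_digraph" and f g where "quiver_cut Q' G f g {}"
proof -
  obtain f where f: "bij_betw f {0..<card (verts G)} (verts G)"
    using ex_bij_betw_nat_finite[OF finite_verts] by blast
  obtain g where g: "bij_betw g {0..<card (arcs G)} (arcs G)"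
    using ex_bij_betw_nat_finite[OF finite_arcs] by blast
  define k where "k = inv_into {0..<card (verts G)} f"
  define Q' where "Q' = \<lparr>verts = {0..<card (verts G)}, arcs = {0..<card (arcs G)},
    tail = (\<lambda>i. k (tail G (g i))), head = (\<lambda>i. k (head G (g i)))\<rparr>"
  have k: "k v \<in> {0..<card (verts G)}" "f (k v) = v" if "v \<in> verts G" for v
    using f that unfolding k_def bij_betw_def by (metis inv_into_into, metis f_inv_into_f)
  have gi: "g i \<in> arcs G" if "i \<in> {0..<card (arcs G)}" for i
    using g that by (auto simp: bij_betw_def)
  have "fin_digraph Q'"
    using k(1)[OF tail_in_verts[OF gi]] k(1)[OF head_in_verts[OF gi]]
    by unfold_locales (auto simp: Q'_def)
  then have "quiver_cut Q' G f g {}"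
    using f g k gi wellformed fin_digraph_axioms
    by (intro quiver_cut.intro quiver_cut_axioms.intro) (auto simp: Q'_def)
  then show ?thesis by (rule that)
qed

text \<open>(S0) and (S1) are verified for the renamed copy \<open>Q'\<close>, while dimension and
  indecomposability are settled over \<open>G\<close>. Renaming preserves lengths, so the bound
  \<open>m\<close> serves both.\<close>

lemma almost_gentle_quadratic_quotient:
  fixes P :: "'b list set"
  defines "I \<equiv> Idl\<^bsub>path_algebra G :: ('k::field, _) module\<^esub> (path_elem G ` P)"
  assumes P: "P \<subseteq> {p. length p = 2 \<and> (\<exists>u v. awalk u p v)}"
    and m: "2 \<le> m" "\<And>p. \<lbrakk>p \<in> quiver_paths G; m \<le> length (snd p)\<rbrakk> \<Longrightarrow> \<exists>q\<in>P. sublist q (snd p)"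
    and r: "\<And>a. a \<in> arcs G \<Longrightarrow> \<exists>\<^sub>\<le>\<^sub>1b. b \<in> arcs G \<and> head G a = tail G b \<and> [a, b] \<notin> P"
    and l: "\<And>a. a \<in> arcs G \<Longrightarrow> \<exists>\<^sub>\<le>\<^sub>1c. c \<in> arcs G \<and> head G c = tail G a \<and> [c, a] \<notin> P"
    and conn: "quiver_connected G" "verts G \<noteq> {}"
  shows "almost_gentle (quotient_algebra (path_algebra G) I)"
proof -
  obtain Q' :: "(nat, nat) pre_digraph" and f g where "quiver_cut Q' G f g {}"
    by (rule quiver_relabel_nat)
  then interpret R: quiver_cut Q' G f g "{}" .
  \<comment> \<open>The walk condition matters: nothing is known about \<open>g\<close> outside the
    arrows of \<open>Q'\<close>, so \<open>map g p \<in> P\<close> alone would not make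
    \<open>p\<close> a path.\<close>
  define P' where "P' = {p. length p = 2 \<and> (\<exists>u v. R.G.awalk u p v) \<and> map g p \<in> P}"
  define I' :: "((nat, nat) quiver_path \<Rightarrow>\<^sub>0 'k) set" where
    "I' = Idl\<^bsub>path_algebra Q'\<^esub> (path_elem Q' ` P')"
  have P': "P' \<subseteq> {p. length p = 2 \<and> (\<exists>u v. R.G.awalk u p v)}" by (auto simp: P'_def)
  have m': "\<exists>q\<in>P'. sublist q (snd p)" if p: "p \<in> quiver_paths Q'" "m \<le> length (snd p)" for p
  proof -
    have "(f (fst p), map g (snd p)) \<in> quiver_paths G"
      using R.map_in_quiver_paths[of "fst p" "snd p"] p by simp
    from m(2)[OF this] p(2) obtain q where q: "q \<in> P" "sublist q (map g (snd p))" by auto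
    then obtain xs ys where "map g (snd p) = xs @ q @ ys" by (auto simp: sublist_def)
    then obtain xs' q' ys' where e: "snd p = xs' @ q' @ ys'" "q = map g q'"
      by (auto simp: map_eq_append_conv append_eq_map_conv)
    have "(fst p, xs' @ q' @ ys') \<in> quiver_paths Q'" using p(1) e(1) by (metis prod.collapse)
    from R.G.quiver_paths_appendD(1)[OF R.G.quiver_paths_appendD(2)[OF this]]
    have "\<exists>u v. R.G.awalk u q' v" by (auto simp: quiver_paths_def)
    then have "q' \<in> P'" using q(1) P e(2) by (auto simp: P'_def)
    then show ?thesis using e(1) by (auto simp: sublist_def)
  qed
  have g: "g a \<in> arcs G" "tail G (g a) = f (tail Q' a)" "head G (g a) = f (head Q' a)" if "a \<in> arcs Q'" for a
    using that R.bij_arcs R.tail[of a] R.head[of a] by (auto simp: bij_betw_def)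
  have g_inj: "a = b" if "a \<in> arcs Q'" "b \<in> arcs Q'" "g a = g b" for a b
    using that R.bij_arcs by (auto simp: bij_betw_def inj_on_def)
  have rel: "[g a, g b] \<notin> P" if "a \<in> arcs Q'" "b \<in> arcs Q'" "head Q' a = tail Q' b" "[a, b] \<notin> P'" for a b
    using that R.G.wellformed by (auto simp: P'_def R.G.awalk_simps)
  have r': "\<exists>\<^sub>\<le>\<^sub>1b. b \<in> arcs Q' \<and> head Q' a = tail Q' b \<and> [a, b] \<notin> P'" if a: "a \<in> arcs Q'" for a
  proof (rule Uniq_I)
    fix b b' assume b: "b \<in> arcs Q' \<and> head Q' a = tail Q' b \<and> [a, b] \<notin> P'"
      and b': "b' \<in> arcs Q' \<and> head Q' a = tail Q' b' \<and> [a, b'] \<notin> P'"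
    have "g b = g b'"
      using r[OF g(1)[OF a], THEN Uniq_D, of "g b" "g b'"] b b' rel[OF a, of b] rel[OF a, of b']
      by (auto simp: g a)
    then show "b = b'" using b b' g_inj by blast
  qed
  have l': "\<exists>\<^sub>\<le>\<^sub>1c. c \<in> arcs Q' \<and> head Q' c = tail Q' a \<and> [c, a] \<notin> P'" if a: "a \<in> arcs Q'" for a
  proof (rule Uniq_I)
    fix b b' assume b: "b \<in> arcs Q' \<and> head Q' b = tail Q' a \<and> [b, a] \<notin> P'"
      and b': "b' \<in> arcs Q' \<and> head Q' b' = tail Q' a \<and> [b', a] \<notin> P'"
    have "g b = g b'"
      using l[OF g(1)[OF a], THEN Uniq_D, of "g b" "g b'"] b b' rel[OF _ a, of b] rel[OF _ a, of b']
      by (auto simp: g a)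
    then show "b = b'" using b b' g_inj by blast
  qed
  have adm': "admissible_ideal Q' I'"
    unfolding I'_def by (rule R.G.admissible_quadratic_ideal[OF P' m(1) m'])
  have adm: "admissible_ideal G I"
    unfolding I_def by (rule admissible_quadratic_ideal[OF P m])
  then have I: "ideal I (path_algebra G)" and I': "ideal I' (path_algebra Q')"
    using adm' by (auto simp: admissible_ideal_def)
  have map_elem: "path_map f g {} (path_elem Q' p) = path_elem G (map g p)" if "p \<in> P'" for p
  proof -
    from that obtain u v where "length p = 2" "R.G.awalk u p v" unfolding P'_def by blast
    moreover from this(1) obtain a b where "p = [a, b]"
      by (auto simp: numeral_2_eq_2 length_Suc_conv)
    ultimately have "p = [a, b]" "a \<in> arcs Q'" by (auto simp: R.G.awalk_Cons_iff)
    then show ?thesis by (simp add: path_elem_def path_map_single g)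
  qed
  \<comment> \<open>Every path in \<open>P\<close> lifts to \<open>Q'\<close>, so the generators
    correspond and, by surjectivity, so do the ideals.\<close>
  have "path_map f g {} ` path_elem Q' ` P' = (path_elem G ` P :: (_ \<Rightarrow>\<^sub>0 'k) set)"
  proof
    show "path_map f g {} ` path_elem Q' ` P' \<subseteq> (path_elem G ` P :: (_ \<Rightarrow>\<^sub>0 'k) set)"
      using map_elem by (auto simp: P'_def)
    have "path_elem G p \<in> path_map f g {} ` path_elem Q' ` P'" if p: "p \<in> P" for p
    proof -
      from p P have "length p = 2" "\<exists>u v. awalk u p v" by auto
      then obtain u where u: "(u, p) \<in> quiver_paths G" "length p = 2" unfolding quiver_paths_def by blast
      then have "u \<in> verts G" using quiver_paths_verts(1) by fastforce
      then obtain w where w: "w \<in> verts Q'" "u = f w" using R.bij_verts by (auto simp: bij_betw_def)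
      then obtain q where q: "(w, q) \<in> quiver_paths Q'" "p = map g q"
        using R.quiver_path_lift[of w p] u(1) by auto
      then have "q \<in> P'" using u(2) p by (auto simp: P'_def quiver_paths_def)
      then show ?thesis using map_elem[of q] q(2) by (metis image_eqI)
    qed
    then show "(path_elem G ` P :: (_ \<Rightarrow>\<^sub>0 'k) set) \<subseteq> path_map f g {} ` path_elem Q' ` P'" by blast
  qed
  moreover have "path_elem Q' ` P' \<subseteq> carrier (path_algebra Q' :: ('k, _) module)"
    using P' R.G.path_elem_long_paths by (fastforce simp: long_paths_def)
  ultimately have image: "path_map f g {} ` I' = I"
    unfolding I'_def I_def
    using ring_hom_ring.image_genideal[OF R.path_map_ring_hom_ring R.path_map_image] by metis
  have "algebra_iso (quotient_algebra (path_algebra Q') I') (quotient_algebra (path_algebra G) I)"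
    using R.quotient_path_algebra_iso[OF I'] unfolding image by simp
  then have "morita_equivalent (quotient_algebra (path_algebra G) I) (quotient_algebra (path_algebra Q') I')"
    by (intro algebra_iso_imp_morita_equivalent k_algebra.k_algebra_quotient_algebra
      R.G.k_algebra_path_algebra k_algebra_path_algebra I I')
  moreover have "cond_S1 Q' I'"
    unfolding I'_def by (rule R.G.cond_S1_quadratic_ideal[OF P' r' l'])
  moreover have "cond_S0 Q' I'" unfolding cond_S0_def I'_def using P' by blast
  ultimately show ?thesis
    unfolding almost_gentle_def
    using k_algebra.k_algebra_quotient_algebra[OF k_algebra_path_algebra I]
      finite_dimensional_quotient_path_algebra[OF adm] connected_imp_indecomposable[OF adm conn]
      R.G.fin_digraph_axioms adm' by blast
qed

end

section \<open>Successors and predecessors of an arrow along the cycles\<close>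

lemma cyclic_perm_append: "cyclic_perm (xs @ ys) (ys @ xs)"
  unfolding cyclic_perm_def by (metis rotate_append)

text \<open>As the entries are distinct, the first one determines the amount of rotation modulo the
  length.\<close>

lemma cyclic_perm_hd_eq:
  assumes "distinct xs" "cyclic_perm xs ys" "xs \<noteq> []" "hd xs = hd ys"
  shows "xs = ys"
proof -
  from assms(2) obtain n where n: "ys = rotate n xs" unfolding cyclic_perm_def by blast
  have "xs ! 0 = xs ! (n mod length xs)"
    using assms(3,4) n hd_rotate_conv_nth[OF assms(3), of n] hd_conv_nth[OF assms(3)] by simp
  then have "n mod length xs = 0"
    using assms(1,3) nth_eq_iff_index_eq[of xs 0 "n mod length xs"] by simp
  then show ?thesis using n by (simp add: rotate_id)
qed

context
  fixes Q :: "('v, 'a) pre_digraph" and T :: "'a list set" and \<nu> :: "'a list \<Rightarrow> nat"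
  assumes dp: "defining_pair Q T \<nu>"
begin

lemma defining_pair_rotate:
  "xs @ ys \<in> T \<Longrightarrow> ys @ xs \<in> T"
  using dp cyclic_perm_append unfolding defining_pair_def by blast

text \<open>By (D4) the two cycles are rotations of each other, and a simple cycle is determined
  among its rotations by its first arrow.\<close>

lemma defining_pair_hd_eq:
  assumes "a # xs \<in> T" "a # ys \<in> T"
  shows "xs = ys"
proof -
  have "distinct (a # xs)" "cyclic_perm (a # xs) (a # ys)"
    using assms dp unfolding defining_pair_def simple_cycle_def
    by (blast, meson list.set_intros(1))
  from cyclic_perm_hd_eq[OF this] show ?thesis by simp
qed

lemma defining_pair_successor_unique:
  assumes "sublist [a, b] C" "sublist [a, b'] C'" "C \<in> T" "C' \<in> T"
  shows "b = b'"
proof -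
  from assms obtain ps ss ps' ss' where "C = ps @ a # b # ss" "C' = ps' @ a # b' # ss'"
    by (auto simp: sublist_def)
  \<comment> \<open>Rotation brings \<open>a\<close> to the front of both cycles, so they coincide
    and so do their second arrows.\<close>
  then have "(a # b # ss) @ ps \<in> T" "(a # b' # ss') @ ps' \<in> T"
    using assms(3,4) defining_pair_rotate by blast+
  then show ?thesis using defining_pair_hd_eq by auto
qed

lemma defining_pair_predecessor_unique:
  assumes "sublist [c, a] C" "sublist [c', a] C'" "C \<in> T" "C' \<in> T"
  shows "c = c'"
proof -
  from assms obtain ps ss ps' ss' where "C = (ps @ [c]) @ a # ss" "C' = (ps' @ [c']) @ a # ss'"
    by (auto simp: sublist_def)
  \<comment> \<open>Here rotation moves the arrow before \<open>a\<close> to the end of the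
    list.\<close>
  then have "(a # ss) @ ps @ [c] \<in> T" "(a # ss') @ ps' @ [c'] \<in> T"
    using assms(3,4) defining_pair_rotate by blast+
  then have "ss @ ps @ [c] = ss' @ ps' @ [c']" using defining_pair_hd_eq by auto
  then show ?thesis by (metis append_assoc last_snoc)
qed

end

section \<open>Admissible cuts\<close>

lemma path_algebra_nat_pow_closed:
  assumes "fin_digraph Q" "Poly_Mapping.keys x \<subseteq> quiver_paths Q"
  shows "Poly_Mapping.keys (x [^]\<^bsub>path_algebra Q\<^esub> (n :: nat)) \<subseteq> quiver_paths Q"
proof -
  interpret fin_digraph Q by fact
  interpret ring "path_algebra Q" by (rule ring_path_algebra)
  show ?thesis using nat_pow_closed[of x n] assms(2) by simp
qed

locale cut_defining_pair = \<Lambda>: fin_digraph Q\<^sub>\<Lambda> for Q\<^sub>\<Lambda> :: "('v, 'a) pre_digraph" +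
  fixes S R :: "'a list set" and \<mu> :: "'a list \<Rightarrow> nat" and D :: "'a set"
  assumes dp: "defining_pair Q\<^sub>\<Lambda> S \<mu>"
    and representatives: "cycle_representatives S R"
    and cut: "admissible_cut Q\<^sub>\<Lambda> R D"
begin

definition Q :: "('v, 'a) pre_digraph" where
  "Q = Q\<^sub>\<Lambda>\<lparr>arcs := arcs Q\<^sub>\<Lambda> - D\<rparr>"

lemma Q_simps [simp]: "verts Q = verts Q\<^sub>\<Lambda>" "arcs Q = arcs Q\<^sub>\<Lambda> - D" "tail Q = tail Q\<^sub>\<Lambda>" "head Q = head Q\<^sub>\<Lambda>"
  by (simp_all add: Q_def)

lemma cycleD:
  assumes "C \<in> S"
  shows "C \<noteq> []" "distinct C" "(tail Q\<^sub>\<Lambda> (hd C), C) \<in> quiver_paths Q\<^sub>\<Lambda>" "\<mu> C > 0"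
    "path_target Q\<^sub>\<Lambda> (tail Q\<^sub>\<Lambda> (hd C), C) = tail Q\<^sub>\<Lambda> (hd C)"
proof -
  have "\<forall>C\<in>S. simple_cycle Q\<^sub>\<Lambda> C \<and> \<mu> C > 0" using dp unfolding defining_pair_def by (rule conjunct1)
  then have C: "simple_cycle Q\<^sub>\<Lambda> C" "\<mu> C > 0" using assms by auto
  then show "C \<noteq> []" "distinct C" "\<mu> C > 0" unfolding simple_cycle_def by auto
  have w: "\<Lambda>.awalk (tail Q\<^sub>\<Lambda> (hd C)) C (tail Q\<^sub>\<Lambda> (hd C))" using C(1) unfolding simple_cycle_def by blast
  then show "(tail Q\<^sub>\<Lambda> (hd C), C) \<in> quiver_paths Q\<^sub>\<Lambda>" unfolding quiver_paths_def by blast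
  show "path_target Q\<^sub>\<Lambda> (tail Q\<^sub>\<Lambda> (hd C), C) = tail Q\<^sub>\<Lambda> (hd C)"
    using \<Lambda>.awlast_of_awalk[OF w] by (simp add: path_target_def)
qed

lemma arc_in_cycle:
  assumes "a \<in> arcs Q\<^sub>\<Lambda>"
  obtains p where "a # p \<in> S"
proof -
  have "\<forall>a\<in>arcs Q\<^sub>\<Lambda>. \<exists>C\<in>S. a \<in> set C" using dp unfolding defining_pair_def by (elim conjE)
  then obtain C xs ys where "C \<in> S" "C = xs @ a # ys" using assms by (metis split_list)
  then have "(a # ys) @ xs \<in> S" using defining_pair_rotate[OF dp] by blast
  then show ?thesis using that by simp
qed

text \<open>The cut condition speaks of representatives only, but a rotation has the same set of
  arrows.\<close>

lemma cut_cycle: "C \<in> S \<Longrightarrow> \<exists>!a. a \<in> D \<inter> set C"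
proof -
  assume "C \<in> S"
  then obtain C' where "C' \<in> R" "cyclic_perm C C'"
    using representatives unfolding cycle_representatives_def by blast
  then have "set C' = set C" "\<exists>!a. a \<in> D \<inter> set C'"
    using cut unfolding admissible_cut_def cyclic_perm_def by auto
  then show ?thesis by simp
qed

lemma D_arcs: "D \<subseteq> arcs Q\<^sub>\<Lambda>"
  using cut by (simp add: admissible_cut_def)

sublocale Q: fin_digraph Q
  by unfold_locales auto

sublocale cut: quiver_cut Q\<^sub>\<Lambda> Q id id D
  by unfold_locales (use D_arcs in auto)

lemma path_target_Q: "path_target Q = path_target Q\<^sub>\<Lambda>"
  by (auto simp: path_target_simp fun_eq_iff)

lemma path_mult_Q: "path_mult Q = path_mult Q\<^sub>\<Lambda>"
  by (simp add: path_mult_def path_target_Q fun_eq_iff)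

lemma path_elem_Q: "path_elem Q = path_elem Q\<^sub>\<Lambda>"
  by (simp add: path_elem_def fun_eq_iff)

lemma quiver_paths_Q: "(u, p) \<in> quiver_paths Q \<longleftrightarrow> (u, p) \<in> quiver_paths Q\<^sub>\<Lambda> \<and> set p \<inter> D = {}"
  by (induction p arbitrary: u) (auto simp: Q.quiver_paths_Cons \<Lambda>.quiver_paths_Cons)

lemma path_map_Q: "Poly_Mapping.keys x \<subseteq> quiver_paths Q \<Longrightarrow> cut.\<pi> x = x"
proof (induction x rule: poly_mapping_span_induct)
  case (single p c)
  then show ?case by (cases p) (auto simp: path_map_single quiver_paths_Q)
qed (simp_all add: path_map_add)

text \<open>Composability is built in because \<open>path_elem\<close> of two arrows that do not
  compose is not 0 but lies outside the path algebra. The last and the first arrow of a cycle of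
  length at least 2 are adjacent in a rotation, which \<open>S\<close> also contains.\<close>

definition relations :: "'a list set" where
  "relations = {[a, b] | a b. a \<in> arcs Q \<and> b \<in> arcs Q \<and> head Q a = tail Q b \<and> (\<forall>C\<in>S. \<not> sublist [a, b] C)}"

definition relation_ideal :: "(('v, 'a) quiver_path \<Rightarrow>\<^sub>0 'k::field) set" where
  "relation_ideal = Idl\<^bsub>path_algebra Q\<^esub> (path_elem Q ` relations)"

lemma relations_walks: "relations \<subseteq> {p. length p = 2 \<and> (\<exists>u v. Q.awalk u p v)}"
proof
  fix p assume "p \<in> relations"
  then obtain a b where p: "p = [a, b]" "a \<in> arcs Q" "b \<in> arcs Q" "head Q a = tail Q b"
    unfolding relations_def by blast
  then have "Q.awalk (tail Q a) p (head Q b)" by (simp add: Q.awalk_simps Q.wellformed del: Q_simps)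
  then show "p \<in> {p. length p = 2 \<and> (\<exists>u v. Q.awalk u p v)}" using p(1) by auto
qed

lemma cut_loop: "[a] \<in> S \<Longrightarrow> a \<in> D"
  using cut_cycle[of "[a]"] by auto

lemma not_relation:
  assumes "a \<in> arcs Q" "b \<in> arcs Q" "head Q a = tail Q b" "[a, b] \<notin> relations"
  shows "\<exists>C\<in>S. sublist [a, b] C"
  using assms unfolding relations_def by blast

lemma relation_free_path_prefix:
  assumes "(u, p) \<in> quiver_paths Q" "p \<noteq> []" "\<And>q. q \<in> relations \<Longrightarrow> \<not> sublist q p"
  shows "\<exists>C\<in>S. prefix p C"
  using assms
proof (induction p rule: rev_induct)
  case (snoc b p)
  have b: "b \<in> arcs Q" using Q.quiver_paths_arcs[OF snoc.prems(1)] by simp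
  show ?case
  proof (cases p rule: rev_cases)
    case Nil
    obtain ys where "b # ys \<in> S" using arc_in_cycle[of b] b by auto
    then show ?thesis unfolding Nil by (intro bexI[of _ "b # ys"]) auto
  next
    case (snoc p' a)
    have "(u, p) \<in> quiver_paths Q" by (rule Q.quiver_paths_appendD(1)[OF snoc.prems(1)])
    moreover have "\<not> sublist q p" if "q \<in> relations" for q
      using snoc.prems(3)[OF that] by (meson sublist_append_rightI sublist_order.order_trans)
    ultimately obtain C where C: "C \<in> S" "prefix p C"
      using snoc.IH snoc by blast
    then obtain cs where cs: "C = p @ cs" by (auto simp: prefix_def)
    \<comment> \<open>\<open>C\<close> contains a cut arrow and \<open>p\<close> does not, so
      \<open>p\<close> is a proper prefix and some \<open>c\<close> follows its last arrow
      \<open>a\<close>. Uniqueness of successors identifies \<open>c\<close> with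
      \<open>b\<close>.\<close>
    have "set p \<inter> D = {}" using Q.quiver_paths_arcs[OF snoc.prems(1)] by auto
    then have "cs \<noteq> []" using cut_cycle[OF C(1)] cs by auto
    then obtain c cs' where c: "C = p' @ [a, c] @ cs'" using cs snoc by (cases cs) auto
    have "(u, p' @ [a, b]) \<in> quiver_paths Q" using snoc.prems(1) snoc by simp
    from Q.quiver_paths_appendD(2)[OF this] have ab: "a \<in> arcs Q" "head Q a = tail Q b"
      by (simp_all add: Q.quiver_paths_Cons del: Q_simps)
    have "sublist [a, b] (p @ [b])" using snoc by (auto simp: sublist_def)
    then have "[a, b] \<notin> relations" using snoc.prems(3) by blast
    then obtain C' where C': "C' \<in> S" "sublist [a, b] C'" using not_relation ab b by blast
    have "sublist [a, c] C" using c by (auto simp: sublist_def)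
    then have "c = b" using defining_pair_successor_unique[OF dp] C(1) C' by blast
    then have "prefix (p @ [b]) C" using c snoc by (auto simp: prefix_def)
    then show ?thesis using C(1) by blast
  qed
qed simp

text \<open>A prefix of a simple cycle has at most \<open>card (arcs Q\<^sub>\<Lambda>)\<close>
  arrows. The summand 2 keeps the bound at least 2, as \<open>admissible_ideal\<close> demands of
  its exponent.\<close>

lemma long_path_contains_relation:
  assumes "p \<in> quiver_paths Q" "card (arcs Q\<^sub>\<Lambda>) + 2 \<le> length (snd p)"
  shows "\<exists>q\<in>relations. sublist q (snd p)"
proof (rule ccontr)
  assume n: "\<not> ?thesis"
  have "snd p \<noteq> []" "(fst p, snd p) \<in> quiver_paths Q" using assms by auto
  then obtain C where C: "C \<in> S" "prefix (snd p) C"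
    using relation_free_path_prefix[of "fst p" "snd p"] n by blast
  have "length (snd p) \<le> length C" using C(2) by (rule prefix_length_le)
  also have "length C = card (set C)" using cycleD(2)[OF C(1)] by (rule distinct_card[symmetric])
  also have "\<dots> \<le> card (arcs Q\<^sub>\<Lambda>)"
    using \<Lambda>.quiver_paths_arcs[OF cycleD(3)[OF C(1)]] by (intro card_mono) auto
  finally show False using assms(2) by simp
qed

lemma relation_successor_unique:
  assumes "a \<in> arcs Q"
  shows "\<exists>\<^sub>\<le>\<^sub>1b. b \<in> arcs Q \<and> head Q a = tail Q b \<and> [a, b] \<notin> relations"
  using not_relation[OF assms] defining_pair_successor_unique[OF dp]
  by (intro Uniq_I) meson

lemma relation_predecessor_unique:
  assumes "a \<in> arcs Q"
  shows "\<exists>\<^sub>\<le>\<^sub>1c. c \<in> arcs Q \<and> head Q c = tail Q a \<and> [c, a] \<notin> relations"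
  using not_relation[OF _ assms] defining_pair_predecessor_unique[OF dp]
  by (intro Uniq_I) meson

lemma connected_Q:
  assumes "quiver_connected Q\<^sub>\<Lambda>"
  shows "quiver_connected Q"
  unfolding quiver_connected_def
proof (intro allI impI)
  fix W assume W: "W \<subseteq> verts Q" "\<forall>a\<in>arcs Q. tail Q a \<in> W \<longleftrightarrow> head Q a \<in> W"
  have "tail Q\<^sub>\<Lambda> a \<in> W \<longleftrightarrow> head Q\<^sub>\<Lambda> a \<in> W" if a: "a \<in> arcs Q\<^sub>\<Lambda>" for a
  proof (cases "a \<in> D")
    case False
    then show ?thesis using W(2) a by simp
  next
    case True
    obtain p where C: "a # p \<in> S" using arc_in_cycle[OF a] .
    \<comment> \<open>\<open>a\<close> is the only cut arrow of its cycle and occurs once, so the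
      remaining piece \<open>p\<close> stays in \<open>Q\<close> and runs from the head of
      \<open>a\<close> back to its tail.\<close>
    have "set (p) \<inter> D = {}"
      using cut_cycle[OF C] cycleD(2)[OF C] True by auto
    moreover have "(head Q\<^sub>\<Lambda> a, p) \<in> quiver_paths Q\<^sub>\<Lambda>"
      using cycleD(3)[OF C] by (simp add: \<Lambda>.quiver_paths_Cons)
    ultimately have "(head Q\<^sub>\<Lambda> a, p) \<in> quiver_paths Q" by (simp add: quiver_paths_Q)
    from Q.closed_vertex_set_path[OF _ this, of W] W(2)
    have "head Q\<^sub>\<Lambda> a \<in> W \<longleftrightarrow> path_target Q (head Q\<^sub>\<Lambda> a, p) \<in> W" by blast
    moreover have "path_target Q (head Q\<^sub>\<Lambda> a, p) = tail Q\<^sub>\<Lambda> a"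
      using cycleD(5)[OF C] by (auto simp: path_target_Q path_target_simp split: if_splits)
    ultimately show ?thesis by simp
  qed
  then show "W = {} \<or> W = verts Q"
    using assms W(1) unfolding quiver_connected_def by simp
qed

section \<open>The image of the defining ideal under the cut\<close>

lemma path_map_cycle_power:
  assumes "C \<in> S"
  shows "cut.\<pi> (path_elem Q\<^sub>\<Lambda> C [^]\<^bsub>path_algebra Q\<^sub>\<Lambda>\<^esub> \<mu> C) = (0 :: _ \<Rightarrow>\<^sub>0 'k::field)"
proof -
  have C: "Poly_Mapping.keys (path_elem Q\<^sub>\<Lambda> C :: _ \<Rightarrow>\<^sub>0 'k) \<subseteq> quiver_paths Q\<^sub>\<Lambda>"
    using cycleD(3)[OF assms] by (simp add: path_elem_def)
  have "set C \<inter> D \<noteq> {}" using cut_cycle[OF assms] by auto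
  then have z: "cut.\<pi> (path_elem Q\<^sub>\<Lambda> C :: _ \<Rightarrow>\<^sub>0 'k) = 0"
    by (simp add: path_elem_def path_map_single)
  \<comment> \<open>A positive exponent leaves a factor that \<open>\<pi>\<close> sends to 0; the
    exponent 0 would give the unit.\<close>
  obtain n where n: "\<mu> C = Suc n" using cycleD(4)[OF assms] gr0_implies_Suc by blast
  show ?thesis
    unfolding n nat_pow_Suc path_algebra_simps(2)
    using cut.path_map_mult[OF path_algebra_nat_pow_closed[OF \<Lambda>.fin_digraph_axioms C] C] z by simp
qed

lemma relations_in_carrier: "path_elem Q ` relations \<subseteq> carrier (path_algebra Q)"
  using relations_walks Q.path_elem_long_paths by (fastforce simp: long_paths_def)

lemma ideal_relation_ideal: "ideal relation_ideal (path_algebra Q :: ('k::field, _) module)"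
  unfolding relation_ideal_def
  by (rule ring.genideal_ideal[OF Q.ring_path_algebra relations_in_carrier])

lemma path_map_defining_relation:
  assumes "x \<in> type1_relations Q\<^sub>\<Lambda> S \<mu> \<union> type2_relations Q\<^sub>\<Lambda> S \<mu> \<union> type3_relations Q\<^sub>\<Lambda> S"
    and "Poly_Mapping.keys x \<subseteq> quiver_paths Q\<^sub>\<Lambda>"
  shows "cut.\<pi> x \<in> (relation_ideal :: (_ \<Rightarrow>\<^sub>0 'k::field) set)"
proof -
  note zero = Q.path_idealD(2)[OF ideal_relation_ideal]
  consider (1) "x \<in> type1_relations Q\<^sub>\<Lambda> S \<mu>" | (2) "x \<in> type2_relations Q\<^sub>\<Lambda> S \<mu>" | (3) "x \<in> type3_relations Q\<^sub>\<Lambda> S"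
    using assms(1) by blast
  then show ?thesis
  proof cases
    case 1
    then have "cut.\<pi> x = 0"
      unfolding type1_relations_def by (auto simp: path_map_diff path_map_cycle_power)
    then show ?thesis using zero by simp
  next
    case 2
    then obtain C where C: "C \<in> S"
      "x = path_mult Q\<^sub>\<Lambda> (path_elem Q\<^sub>\<Lambda> C [^]\<^bsub>path_algebra Q\<^sub>\<Lambda>\<^esub> \<mu> C) (arrow_elem Q\<^sub>\<Lambda> (hd C))"
      unfolding type2_relations_def by auto
    have "hd C \<in> arcs Q\<^sub>\<Lambda>"
      using \<Lambda>.quiver_paths_arcs[OF cycleD(3)[OF C(1)]] hd_in_set[OF cycleD(1)[OF C(1)]] by blast
    then have a: "Poly_Mapping.keys (arrow_elem Q\<^sub>\<Lambda> (hd C) :: _ \<Rightarrow>\<^sub>0 'k) \<subseteq> quiver_paths Q\<^sub>\<Lambda>"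
      by (simp add: arrow_elem_def path_elem_def \<Lambda>.quiver_paths_Cons)
    have c: "Poly_Mapping.keys (path_elem Q\<^sub>\<Lambda> C :: _ \<Rightarrow>\<^sub>0 'k) \<subseteq> quiver_paths Q\<^sub>\<Lambda>"
      using cycleD(3)[OF C(1)] by (simp add: path_elem_def)
    have "cut.\<pi> x = 0"
      unfolding C(2)
      using cut.path_map_mult[OF path_algebra_nat_pow_closed[OF \<Lambda>.fin_digraph_axioms c] a]
        path_map_cycle_power[OF C(1), where 'k = 'k] by simp
    then show ?thesis using zero by simp
  next
    case 3
    then obtain a b where ab: "a \<in> arcs Q\<^sub>\<Lambda>" "b \<in> arcs Q\<^sub>\<Lambda>" "\<forall>C\<in>S. \<not> sublist [a, b] C"
      "x = path_mult Q\<^sub>\<Lambda> (arrow_elem Q\<^sub>\<Lambda> a) (arrow_elem Q\<^sub>\<Lambda> b)"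
      unfolding type3_relations_def by auto
    show ?thesis
    proof (cases "a \<notin> D \<and> b \<notin> D \<and> head Q\<^sub>\<Lambda> a = tail Q\<^sub>\<Lambda> b")
      case True
      then have "[a, b] \<in> relations" using ab by (simp add: relations_def)
      moreover have "cut.\<pi> x = path_elem Q [a, b]"
        using True ab(4) by (simp add: arrow_elem_mult path_elem_def path_map_single)
      ultimately show ?thesis
        unfolding relation_ideal_def genideal_def by auto
    next
      case False
      \<comment> \<open>Either the arrows do not compose and the product is already 0, or it runs
        through a cut arrow.\<close>
      then have "cut.\<pi> x = 0"
        using ab(4) by (auto simp: arrow_elem_mult path_elem_def path_map_single)
      then show ?thesis using zero by simp
    qed
  qed
qed

context
  fixes I :: "(('v, 'a) quiver_path \<Rightarrow>\<^sub>0 'k::field) set"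
  assumes I_def: "I = defining_ideal Q\<^sub>\<Lambda> S \<mu>"
    and ideal_I: "ideal I (path_algebra Q\<^sub>\<Lambda>)"
begin

text \<open>The preimage of \<open>relation_ideal\<close> under \<open>\<pi>\<close> is an ideal
  that contains the defining relations, hence also the ideal they generate.\<close>

lemma path_map_defining_ideal:
  assumes "x \<in> I"
  shows "cut.\<pi> x \<in> relation_ideal"
proof -
  let ?X = "type1_relations Q\<^sub>\<Lambda> S \<mu> \<union> type2_relations Q\<^sub>\<Lambda> S \<mu> \<union> type3_relations Q\<^sub>\<Lambda> S :: (_ \<Rightarrow>\<^sub>0 'k) set"
  \<comment> \<open>Since \<open>I\<close> is contained in the path algebra, this places the
    relations in its carrier.\<close>
  have "?X \<subseteq> I" unfolding I_def defining_ideal_def genideal_def by blast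
  then have "?X \<subseteq> {x \<in> carrier (path_algebra Q\<^sub>\<Lambda>). cut.\<pi> x \<in> relation_ideal}"
    using \<Lambda>.path_idealD(1)[OF ideal_I] path_map_defining_relation by auto
  then have "I \<subseteq> {x \<in> carrier (path_algebra Q\<^sub>\<Lambda>). cut.\<pi> x \<in> relation_ideal}"
    unfolding I_def defining_ideal_def
    by (intro ring.genideal_minimal[OF \<Lambda>.ring_path_algebra]
        ring_hom_ring.ideal_vimage[OF cut.path_map_ring_hom_ring] ideal_relation_ideal)
  then show ?thesis using assms by blast
qed

text \<open>The exception for loops in the relations of type 3 does not occur in \<open>Q\<close>: such a loop
  is a cycle of length 1 and hence lies in \<open>D\<close>.\<close>

lemma relation_ideal_subset: "relation_ideal \<subseteq> I"
proof -
  interpret R: ring "path_algebra Q :: ('k, _) module" by (rule Q.ring_path_algebra)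
  have sub: "Poly_Mapping.keys x \<subseteq> quiver_paths Q \<Longrightarrow> Poly_Mapping.keys x \<subseteq> quiver_paths Q\<^sub>\<Lambda>" for x :: "_ \<Rightarrow>\<^sub>0 'k"
    using quiver_paths_Q by auto
  \<comment> \<open>\<open>KQ\<close> is a subalgebra with the same operations, so the intersection
    absorbs multiplication by its elements.\<close>
  have "ideal (I \<inter> carrier (path_algebra Q)) (path_algebra Q)"
  proof (rule R.idealI_mult_closed)
    fix x y :: "_ \<Rightarrow>\<^sub>0 'k" assume "x \<in> I \<inter> carrier (path_algebra Q)" "y \<in> I \<inter> carrier (path_algebra Q)"
    then show "x \<oplus>\<^bsub>path_algebra Q\<^esub> y \<in> I \<inter> carrier (path_algebra Q)"
      using \<Lambda>.path_idealD(3)[OF ideal_I] R.a_closed[of x y] by simp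
  next
    fix x r :: "_ \<Rightarrow>\<^sub>0 'k" assume "x \<in> I \<inter> carrier (path_algebra Q)" "r \<in> carrier (path_algebra Q)"
    then show "r \<otimes>\<^bsub>path_algebra Q\<^esub> x \<in> I \<inter> carrier (path_algebra Q)"
      "x \<otimes>\<^bsub>path_algebra Q\<^esub> r \<in> I \<inter> carrier (path_algebra Q)"
      using \<Lambda>.path_idealD(5,6)[OF ideal_I, of x r] sub[of r] R.m_closed[of x r] R.m_closed[of r x]
      by (simp_all add: path_mult_Q)
  qed (use \<Lambda>.path_idealD(2)[OF ideal_I] in auto)
  moreover have "path_elem Q ` relations \<subseteq> I \<inter> carrier (path_algebra Q)"
  proof
    fix x :: "_ \<Rightarrow>\<^sub>0 'k" assume x: "x \<in> path_elem Q ` relations"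
    then obtain a b where ab: "x = path_elem Q [a, b]" "a \<in> arcs Q" "b \<in> arcs Q" "head Q a = tail Q b"
      "\<forall>C\<in>S. \<not> sublist [a, b] C" unfolding relations_def by blast
    have "x = path_mult Q\<^sub>\<Lambda> (arrow_elem Q\<^sub>\<Lambda> a) (arrow_elem Q\<^sub>\<Lambda> b)"
      using ab(1,4) by (simp add: arrow_elem_mult path_elem_Q)
    then have "x \<in> type3_relations Q\<^sub>\<Lambda> S"
      using ab(2,3,5) cut_loop[of a] unfolding type3_relations_def path_algebra_simps(2) by auto
    then have "x \<in> I" unfolding I_def defining_ideal_def genideal_def by blast
    then show "x \<in> I \<inter> carrier (path_algebra Q)" using x relations_in_carrier by blast
  qed
  ultimately have "relation_ideal \<subseteq> I \<inter> carrier (path_algebra Q)"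
    unfolding relation_ideal_def by (rule R.genideal_minimal)
  then show ?thesis by blast
qed

text \<open>\<open>\<pi>\<close> fixes \<open>KQ\<close> and carries \<open>I\<close> into
  \<open>relation_ideal\<close>, which in turn lies in \<open>I\<close>.\<close>

lemma defining_ideal_inter: "I \<inter> carrier (path_algebra Q) = relation_ideal"
proof
  show "I \<inter> carrier (path_algebra Q) \<subseteq> relation_ideal"
    using path_map_defining_ideal path_map_Q by fastforce
  show "relation_ideal \<subseteq> I \<inter> carrier (path_algebra Q)"
    using relation_ideal_subset Q.path_idealD(1)[OF ideal_relation_ideal] by blast
qed

text \<open>The ideal defining the cut algebra contains the arrows of \<open>D\<close> and with them
  the kernel of \<open>\<pi>\<close>, so it remains to see that its image is
  \<open>relation_ideal\<close>.\<close>

lemma cut_algebra_iso: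
  "algebra_iso (cut_algebra Q\<^sub>\<Lambda> I D) (quotient_algebra (path_algebra Q) relation_ideal)"
proof -
  interpret R: ring "path_algebra Q\<^sub>\<Lambda> :: ('k, _) module" by (rule \<Lambda>.ring_path_algebra)
  let ?X = "I \<union> arrow_elem Q\<^sub>\<Lambda> ` D" and ?V = "{x \<in> carrier (path_algebra Q\<^sub>\<Lambda>). cut.\<pi> x \<in> relation_ideal}"
  let ?K = "Idl\<^bsub>path_algebra Q\<^sub>\<Lambda>\<^esub> ?X"
  have "Poly_Mapping.keys (arrow_elem Q\<^sub>\<Lambda> a :: _ \<Rightarrow>\<^sub>0 'k) \<subseteq> quiver_paths Q\<^sub>\<Lambda>" if "a \<in> D" for a
    using that D_arcs by (auto simp: arrow_elem_def path_elem_def \<Lambda>.quiver_paths_Cons)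
  then have arr: "arrow_elem Q\<^sub>\<Lambda> ` D \<subseteq> carrier (path_algebra Q\<^sub>\<Lambda> :: ('k, _) module)" by auto
  have X: "?X \<subseteq> carrier (path_algebra Q\<^sub>\<Lambda>)" using arr \<Lambda>.path_idealD(1)[OF ideal_I] by blast
  have XK: "?X \<subseteq> ?K" by (rule R.genideal_self[OF X])
  have "cut.\<pi> (arrow_elem Q\<^sub>\<Lambda> a :: _ \<Rightarrow>\<^sub>0 'k) = 0" if "a \<in> D" for a
    using that by (simp add: arrow_elem_def path_elem_def path_map_single)
  then have "?X \<subseteq> ?V"
    using X path_map_defining_ideal Q.path_idealD(2)[OF ideal_relation_ideal] by auto
  then have "?K \<subseteq> ?V"
    by (intro R.genideal_minimal ring_hom_ring.ideal_vimage[OF cut.path_map_ring_hom_ring] ideal_relation_ideal)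
  then have "cut.\<pi> ` ?K \<subseteq> relation_ideal" by blast
  \<comment> \<open>Elements of \<open>relation_ideal\<close> already lie in \<open>I\<close> and
    are fixed by \<open>\<pi>\<close>, so they are their own preimages.\<close>
  moreover have "relation_ideal \<subseteq> cut.\<pi> ` ?K"
  proof
    fix x :: "_ \<Rightarrow>\<^sub>0 'k" assume x: "x \<in> relation_ideal"
    then have "cut.\<pi> x = x" using Q.path_idealD(1)[OF ideal_relation_ideal] by (intro path_map_Q) auto
    moreover have "x \<in> ?K" using x relation_ideal_subset XK by blast
    ultimately show "x \<in> cut.\<pi> ` ?K" by (metis image_eqI)
  qed
  ultimately have "cut.\<pi> ` ?K = relation_ideal" by (rule equalityI)
  then show ?thesis
    using cut.quotient_path_algebra_iso[OF R.genideal_ideal[OF X]] XK unfolding cut_algebra_def by simp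
qed

lemma almost_gentle_cut:
  assumes "I \<subseteq> long_paths Q\<^sub>\<Lambda> 2" "indecomposable_algebra (quotient_algebra (path_algebra Q\<^sub>\<Lambda>) I)"
  shows "almost_gentle (quotient_algebra (path_algebra Q) (relation_ideal :: (_ \<Rightarrow>\<^sub>0 'k) set))"
  unfolding relation_ideal_def
proof (rule Q.almost_gentle_quadratic_quotient[where m = "card (arcs Q\<^sub>\<Lambda>) + 2",
      OF relations_walks _ long_path_contains_relation relation_successor_unique relation_predecessor_unique])
  show "quiver_connected Q"
    by (rule connected_Q[OF \<Lambda>.indecomposable_imp_connected(1)[OF ideal_I assms]])
  show "verts Q \<noteq> {}"
    using \<Lambda>.indecomposable_imp_connected(2)[OF ideal_I assms] by simp
qed simp_all

end

end

theorem theorem5p2: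
  fixes Q\<^sub>\<Lambda> Q :: "('v, 'a) pre_digraph"
    and S R :: "'a list set"
    and \<mu> :: "'a list \<Rightarrow> nat"
    and D :: "'a set"
    and I\<^sub>\<Lambda> :: "(('v, 'a) quiver_path \<Rightarrow>\<^sub>0 'k::field) set"
    and \<Lambda> :: "('k, (('v, 'a) quiver_path \<Rightarrow>\<^sub>0 'k) set) module"
  assumes "fin_digraph Q\<^sub>\<Lambda>"
    and "defining_pair Q\<^sub>\<Lambda> S \<mu>"
    and "I\<^sub>\<Lambda> = defining_ideal Q\<^sub>\<Lambda> S \<mu>"
    and "admissible_ideal Q\<^sub>\<Lambda> I\<^sub>\<Lambda>"
    and "\<Lambda> = quotient_algebra (path_algebra Q\<^sub>\<Lambda>) I\<^sub>\<Lambda>"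
    and "symmetric_algebra \<Lambda>"
    and "special_multiserial \<Lambda>"
    and "cycle_representatives S R"
    and "admissible_cut Q\<^sub>\<Lambda> R D"
    and "Q = Q\<^sub>\<Lambda>\<lparr>arcs := arcs Q\<^sub>\<Lambda> - D\<rparr>"
  shows "algebra_iso (cut_algebra Q\<^sub>\<Lambda> I\<^sub>\<Lambda> D)
           (quotient_algebra (path_algebra Q) (I\<^sub>\<Lambda> \<inter> carrier (path_algebra Q)))
       \<and> almost_gentle (quotient_algebra (path_algebra Q) (I\<^sub>\<Lambda> \<inter> carrier (path_algebra Q)))"
proof -
  interpret L: cut_defining_pair Q\<^sub>\<Lambda> S R \<mu> D
    using assms by (intro cut_defining_pair.intro cut_defining_pair_axioms.intro)
  have Q: "Q = L.Q" using assms(10) by (simp add: L.Q_def)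
  have I: "ideal I\<^sub>\<Lambda> (path_algebra Q\<^sub>\<Lambda>)" "I\<^sub>\<Lambda> \<subseteq> long_paths Q\<^sub>\<Lambda> 2"
    using assms(4) by (auto simp: L.\<Lambda>.admissible_ideal_iff)
  have "indecomposable_algebra (quotient_algebra (path_algebra Q\<^sub>\<Lambda>) I\<^sub>\<Lambda>)"
    using assms(5,7) by (simp add: special_multiserial_def)
  then show ?thesis
    unfolding Q L.defining_ideal_inter[OF assms(3) I(1)]
    using L.cut_algebra_iso[OF assms(3) I(1)] L.almost_gentle_cut[OF assms(3) I] by blast
qed

end
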